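(* Let $G$ be a Garside group with Garside element $\Delta$ and simple divisors $\mathcal{D}$, and let $B_{\mathcal{D}}=G\backslash\widehat{\mathcal{X}}_{\mathcal{D}}$ be the quotient of $\widehat{\mathcal{X}}_{\mathcal{D}}$ by the action of $G$. Then $B_{\mathcal{D}}$ has one $k$-cell for every element of $\mathcal{D}_k$. In particular, if $d=\|\Delta\|$, then there is a free resolution of $\mathbb{Z}$ as a trivial $\mathbb{Z}G$-module of the form $$0\to \mathbb{Z}G^{|\mathcal{D}_d|}\to\cdots\to \mathbb{Z}G^{|\mathcal{D}_2|}\to \mathbb{Z}G^{|\mathcal{D}_1|}\to \mathbb{Z}G\xrightarrow{\ \epsilon\ }\mathbb{Z}\to 0 ,$$ where $\epsilon$ is the augmentation.
   Context: An element $m\neq 1$ of a monoid $M$ is indivisible if $m=ab$ implies $a=1$ or $b=1$. For $m\in M$, $\|m\|$ is the supremum of the lengths of all expressions of $m$ as a product of indivisible elements. $M$ is atomic if it is generated by its indivisible elements and $\|m\|<\infty$ for all $m$. A Garside monoid is an atomic monoid $M$ such that: (1) left and right cancellation laws hold; (2) any two elements admit a least common multiple and a greatest common divisor on both the left and the right; (3) there is an element $\Delta\in M$ (Garside element) whose set of left divisors equals its set of right divisors, this set $\mathcal{D}$ (the simple divisors) is finite, and it generates $M$. A Garside monoid $G^+$ embeds in its group of fractions $G$, called a Garside group. A flag complex is a simplicial complex in which every complete subgraph on $n$ vertices of the $1$-skeleton is the $1$-skeleton of an $(n-1)$-simplex. $\widehat{\mathcal{X}}_{\mathcal{D}}$ is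 the flag complex whose $1$-skeleton is the Cayley graph with vertex set $G$ and an edge from $g$ to $g\mu$ for $g\in G$, $\mu\in\mathcal{D}\setminus\{1\}$; $G$ acts on it by left multiplication. $\mathcal{D}_k$ denotes the set of all ordered $k$-tuples $[\mu_1|\cdots|\mu_k]$ of elements of $\mathcal{D}\setminus\{1\}$ such that the product $\mu_1\cdots\mu_k$ lies in $\mathcal{D}$ (for $k=0$ there is exactly one, empty, tuple). In particular $\mathcal{D}_1=\mathcal{D}\setminus\{1\}$. *)

theory Defs
  imports
    "HOL-Algebra.Divisibility"
    "HOL-Algebra.Group_Action"
    "HOL-Algebra.Module"
    "HOL-Algebra.AbelCoset"
    "HOL-Homology.Simplices"
    "HOL-Library.Extended_Nat"
begin

section \<open>Garside monoids and Garside groups\<close>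

definition list_product :: "('a, 'm) monoid_scheme \<Rightarrow> 'a list \<Rightarrow> 'a"
  where "list_product M as = foldr (\<lambda>a b. a \<otimes>\<^bsub>M\<^esub> b) as \<one>\<^bsub>M\<^esub>"

definition opposite :: "('a, 'm) monoid_scheme \<Rightarrow> ('a, 'm) monoid_scheme"
  where "opposite M = M\<lparr>monoid.mult := \<lambda>a b. b \<otimes>\<^bsub>M\<^esub> a\<rparr>"

definition indivisible :: "('a, 'm) monoid_scheme \<Rightarrow> 'a \<Rightarrow> bool"
  where "indivisible M m \<longleftrightarrow> m \<in> carrier M \<and> m \<noteq> \<one>\<^bsub>M\<^esub> \<and>
    (\<forall>a\<in>carrier M. \<forall>b\<in>carrier M. m = a \<otimes>\<^bsub>M\<^esub> b \<longrightarrow> a = \<one>\<^bsub>M\<^esub> \<or> b = \<one>\<^bsub>M\<^esub>)"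

definition monoid_generated_by :: "('a, 'm) monoid_scheme \<Rightarrow> 'a set \<Rightarrow> bool"
  where "monoid_generated_by M S \<longleftrightarrow>
    S \<subseteq> carrier M \<and> (\<forall>m\<in>carrier M. \<exists>as. set as \<subseteq> S \<and> list_product M as = m)"

definition atom_length :: "('a, 'm) monoid_scheme \<Rightarrow> 'a \<Rightarrow> enat"
  where "atom_length M m =
    (SUP as \<in> {as. set as \<subseteq> Collect (indivisible M) \<and> list_product M as = m}. enat (length as))"

definition atomic_monoid :: "('a, 'm) monoid_scheme \<Rightarrow> bool"
  where "atomic_monoid M \<longleftrightarrow> monoid M \<and>
    monoid_generated_by M (Collect (indivisible M)) \<and>
    (\<forall>m\<in>carrier M. atom_length M m < \<infinity>)"

text \<open>The library relation \<open>a divides\<^bsub>M\<^esub> b\<close> unfolds to \<open>\<exists>c\<in>carrier M. b = a \<otimes>\<^bsub>M\<^esub> c\<close>, so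
  for a noncommutative monoid it says that \<open>a\<close> is a left divisor of \<open>b\<close>; right divisibility in
  \<open>M\<close> is \<open>divides\<close> in \<open>opposite M\<close>. The same applies to \<open>gcdof\<close> and \<open>lcmof\<close>.\<close>

definition left_divisors :: "('a, 'm) monoid_scheme \<Rightarrow> 'a \<Rightarrow> 'a set"
  where "left_divisors M m = {a \<in> carrier M. a divides\<^bsub>M\<^esub> m}"

definition right_divisors :: "('a, 'm) monoid_scheme \<Rightarrow> 'a \<Rightarrow> 'a set"
  where "right_divisors M m = {a \<in> carrier M. a divides\<^bsub>opposite M\<^esub> m}"

definition has_gcds_lcms :: "('a, 'm) monoid_scheme \<Rightarrow> bool"
  where "has_gcds_lcms M \<longleftrightarrow> (\<forall>a\<in>carrier M. \<forall>b\<in>carrier M.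
    (\<exists>c\<in>carrier M. c gcdof\<^bsub>M\<^esub> a b) \<and> (\<exists>c\<in>carrier M. c lcmof\<^bsub>M\<^esub> a b))"

definition garside_element :: "('a, 'm) monoid_scheme \<Rightarrow> 'a \<Rightarrow> bool"
  where "garside_element M \<Delta> \<longleftrightarrow> \<Delta> \<in> carrier M \<and>
    left_divisors M \<Delta> = right_divisors M \<Delta> \<and>
    finite (left_divisors M \<Delta>) \<and>
    monoid_generated_by M (left_divisors M \<Delta>)"

definition simple_divisors :: "('a, 'm) monoid_scheme \<Rightarrow> 'a \<Rightarrow> 'a set"
  where "simple_divisors M \<Delta> = left_divisors M \<Delta>"

definition garside_monoid :: "('a, 'm) monoid_scheme \<Rightarrow> bool"
  where "garside_monoid M \<longleftrightarrow> atomic_monoid M \<and> monoid_cancel M \<and>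
    has_gcds_lcms M \<and> has_gcds_lcms (opposite M) \<and> (\<exists>\<Delta>. garside_element M \<Delta>)"

text \<open>\<open>G\<close> is the group of fractions of its submonoid \<open>P\<close>, which is a Garside monoid.\<close>

definition garside_group :: "('a, 'm) monoid_scheme \<Rightarrow> 'a set \<Rightarrow> bool"
  where "garside_group G P \<longleftrightarrow> group G \<and> submonoid P G \<and>
    garside_monoid (G\<lparr>carrier := P\<rparr>) \<and>
    (\<forall>g\<in>carrier G. \<exists>a\<in>P. \<exists>b\<in>P. g = a \<otimes>\<^bsub>G\<^esub> inv\<^bsub>G\<^esub> b)"

definition simple_tuples :: "('a, 'm) monoid_scheme \<Rightarrow> 'a set \<Rightarrow> nat \<Rightarrow> 'a list set"
  where "simple_tuples G D k =
    {\<mu>s. length \<mu>s = k \<and> set \<mu>s \<subseteq> D - {\<one>\<^bsub>G\<^esub>} \<and> list_product G \<mu>s \<in> D}"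


section \<open>Simplicial complexes and the flag complex of a Garside group\<close>

text \<open>A simplicial complex is given by the set of its (nonempty) simplices, a simplex being the
  set of its vertices.\<close>

definition abstract_simplicial_complex :: "'v set set \<Rightarrow> bool"
  where "abstract_simplicial_complex K \<longleftrightarrow> (\<forall>\<sigma>\<in>K. finite \<sigma> \<and> \<sigma> \<noteq> {}) \<and>
    (\<forall>\<sigma>\<in>K. \<forall>\<tau>. \<tau> \<subseteq> \<sigma> \<and> \<tau> \<noteq> {} \<longrightarrow> \<tau> \<in> K)"

definition is_flag_complex :: "'v set set \<Rightarrow> bool"
  where "is_flag_complex K \<longleftrightarrow> abstract_simplicial_complex K \<and>
    (\<forall>\<sigma>. finite \<sigma> \<and> \<sigma> \<noteq> {} \<and> (\<forall>v\<in>\<sigma>. \<forall>w\<in>\<sigma>. {v, w} \<in> K) \<longrightarrow> \<sigma> \<in> K)"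

definition flag_complex :: "'v set \<Rightarrow> 'v set set \<Rightarrow> 'v set set"
  where "flag_complex V E =
    {\<sigma>. finite \<sigma> \<and> \<sigma> \<noteq> {} \<and> \<sigma> \<subseteq> V \<and> (\<forall>v\<in>\<sigma>. \<forall>w\<in>\<sigma>. v \<noteq> w \<longrightarrow> {v, w} \<in> E)}"

text \<open>This is the unique flag complex whose \<open>1\<close>-skeleton is the graph \<open>(V, E)\<close>.\<close>

lemma flag_complex_unique:
  assumes E: "\<And>e. e \<in> E \<Longrightarrow> e \<subseteq> V \<and> card e = 2"
  shows "is_flag_complex K \<and> \<Union>K = V \<and> {\<sigma>\<in>K. card \<sigma> = 2} = E \<longleftrightarrow> K = flag_complex V E"
proof
  assume L: "is_flag_complex K \<and> \<Union>K = V \<and> {\<sigma>\<in>K. card \<sigma> = 2} = E"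
  have sub: "\<And>\<sigma> \<tau>. \<lbrakk>\<sigma> \<in> K; \<tau> \<subseteq> \<sigma>; \<tau> \<noteq> {}\<rbrakk> \<Longrightarrow> \<tau> \<in> K"
    and fin: "\<And>\<sigma>. \<sigma> \<in> K \<Longrightarrow> finite \<sigma> \<and> \<sigma> \<noteq> {}"
    and fl: "\<And>\<sigma>. \<lbrakk>finite \<sigma>; \<sigma> \<noteq> {}; \<And>v w. \<lbrakk>v \<in> \<sigma>; w \<in> \<sigma>\<rbrakk> \<Longrightarrow> {v, w} \<in> K\<rbrakk> \<Longrightarrow> \<sigma> \<in> K"
    using L unfolding is_flag_complex_def abstract_simplicial_complex_def by blast+
  have V: "\<And>v. v \<in> V \<longleftrightarrow> {v} \<in> K"
    using L sub by (metis UnionE Union_upper empty_not_insert empty_subsetI insert_subset)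
  have e: "\<And>v w. v \<noteq> w \<Longrightarrow> {v, w} \<in> E \<longleftrightarrow> {v, w} \<in> K"
    using L by auto
  show "K = flag_complex V E"
  proof (intro Set.set_eqI iffI)
    fix \<sigma> assume s: "\<sigma> \<in> K"
    have "{v, w} \<in> E" if "v \<in> \<sigma>" "w \<in> \<sigma>" "v \<noteq> w" for v w
      using e[OF that(3)] sub[OF s, of "{v, w}"] that by auto
    then show "\<sigma> \<in> flag_complex V E"
      using fin[OF s] s L unfolding flag_complex_def by blast
  next
    fix \<sigma> assume s: "\<sigma> \<in> flag_complex V E"
    show "\<sigma> \<in> K"
    proof (rule fl)
      show "finite \<sigma>" "\<sigma> \<noteq> {}" using s by (auto simp: flag_complex_def)
      fix v w assume vw: "v \<in> \<sigma>" "w \<in> \<sigma>"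
      show "{v, w} \<in> K"
      proof (cases "v = w")
        case True
        then show ?thesis using s vw V unfolding flag_complex_def by auto
      next
        case False
        then show ?thesis using s vw e unfolding flag_complex_def by auto
      qed
    qed
  qed
next
  assume R: "K = flag_complex V E"
  have sc: "abstract_simplicial_complex K"
    unfolding R abstract_simplicial_complex_def flag_complex_def
    by (auto intro: finite_subset)
  have vE: "\<And>v w. {v, w} \<in> K \<longleftrightarrow> v \<in> V \<and> w \<in> V \<and> (v \<noteq> w \<longrightarrow> {v, w} \<in> E)"
    unfolding R flag_complex_def by (auto simp: insert_commute)
  have cl: "\<sigma> \<in> K"
    if "finite \<sigma>" "\<sigma> \<noteq> {}" "\<forall>v\<in>\<sigma>. \<forall>w\<in>\<sigma>. {v, w} \<in> K" for \<sigma>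
  proof -
    have "v \<in> V" if "v \<in> \<sigma>" for v using \<open>\<forall>v\<in>\<sigma>. \<forall>w\<in>\<sigma>. {v, w} \<in> K\<close> vE[of v v] that by fastforce
    moreover have "{v, w} \<in> E" if "v \<in> \<sigma>" "w \<in> \<sigma>" "v \<noteq> w" for v w
      using \<open>\<forall>v\<in>\<sigma>. \<forall>w\<in>\<sigma>. {v, w} \<in> K\<close> vE[of v w] that by fast
    ultimately show ?thesis using that(1,2) unfolding R flag_complex_def by blast
  qed
  have "is_flag_complex K"
    unfolding is_flag_complex_def by (intro conjI sc allI impI, elim conjE) (rule cl)
  moreover have "\<Union>K = V"
  proof
    show "V \<subseteq> \<Union>K"
    proof
      fix v assume "v \<in> V"
      then have "{v, v} \<in> K" using vE[of v v] by simp
      then show "v \<in> \<Union>K" by blast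
    qed
  next
    show "\<Union>K \<subseteq> V" unfolding R flag_complex_def by blast
  qed
  moreover have "{\<sigma>\<in>K. card \<sigma> = 2} = E"
  proof (intro Set.set_eqI iffI)
    fix \<sigma> assume "\<sigma> \<in> {\<sigma>\<in>K. card \<sigma> = 2}"
    then obtain v w where "\<sigma> = {v, w}" "v \<noteq> w" "{v, w} \<in> K" by (auto simp: card_2_iff)
    then show "\<sigma> \<in> E" using vE[of v w] by simp
  next
    fix \<sigma> assume s: "\<sigma> \<in> E"
    then obtain v w where "\<sigma> = {v, w}" "v \<noteq> w" using E by (meson card_2_iff)
    then show "\<sigma> \<in> {\<sigma>\<in>K. card \<sigma> = 2}" using s vE[of v w] E[OF s] by simp
  qed
  ultimately show "is_flag_complex K \<and> \<Union>K = V \<and> {\<sigma>\<in>K. card \<sigma> = 2} = E"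
    by blast
qed

definition cayley_edges :: "('a, 'm) monoid_scheme \<Rightarrow> 'a set \<Rightarrow> 'a set set"
  where "cayley_edges G D = {{g, g \<otimes>\<^bsub>G\<^esub> \<mu>} | g \<mu>. g \<in> carrier G \<and> \<mu> \<in> D - {\<one>\<^bsub>G\<^esub>}}"

definition garside_complex :: "('a, 'm) monoid_scheme \<Rightarrow> 'a set \<Rightarrow> 'a set set"
  where "garside_complex G D = flag_complex (carrier G) (cayley_edges G D)"


section \<open>Geometric realization and quotient by the group action\<close>

text \<open>A point of the realization is its function of barycentric coordinates.\<close>

definition realization :: "'v set set \<Rightarrow> ('v \<Rightarrow> real) set"
  where "realization K =
    {\<alpha>. {v. \<alpha> v \<noteq> 0} \<in> K \<and> (\<forall>v. 0 \<le> \<alpha> v) \<and> (\<Sum>v | \<alpha> v \<noteq> 0. \<alpha> v) = 1}"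

definition closed_simplex :: "'v set set \<Rightarrow> 'v set \<Rightarrow> ('v \<Rightarrow> real) set"
  where "closed_simplex K \<sigma> = {\<alpha> \<in> realization K. {v. \<alpha> v \<noteq> 0} \<subseteq> \<sigma>}"

definition open_simplex :: "'v set set \<Rightarrow> 'v set \<Rightarrow> ('v \<Rightarrow> real) set"
  where "open_simplex K \<sigma> = {\<alpha> \<in> realization K. {v. \<alpha> v \<noteq> 0} = \<sigma>}"

text \<open>The weak topology: a set is open iff it meets every closed simplex in a relatively open
  set. (On a single closed simplex the product topology of \<open>'v \<Rightarrow> real\<close> is the Euclidean one.)\<close>

definition realization_topology :: "'v set set \<Rightarrow> ('v \<Rightarrow> real) topology"
  where "realization_topology K = topology (\<lambda>U. U \<subseteq> realization K \<and>
    (\<forall>\<sigma>\<in>K. openin (top_of_set (closed_simplex K \<sigma>)) (U \<inter> closed_simplex K \<sigma>)))"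

lemma openin_realization_topology:
  "openin (realization_topology K) U \<longleftrightarrow> U \<subseteq> realization K \<and>
    (\<forall>\<sigma>\<in>K. openin (top_of_set (closed_simplex K \<sigma>)) (U \<inter> closed_simplex K \<sigma>))"
proof -
  have "istopology (\<lambda>U. U \<subseteq> realization K \<and>
    (\<forall>\<sigma>\<in>K. openin (top_of_set (closed_simplex K \<sigma>)) (U \<inter> closed_simplex K \<sigma>)))"
    unfolding istopology_def
  proof (rule conjI; clarify)
    fix S T \<sigma>
    assume "\<forall>\<sigma>\<in>K. openin (top_of_set (closed_simplex K \<sigma>)) (S \<inter> closed_simplex K \<sigma>)"
      and "\<forall>\<sigma>\<in>K. openin (top_of_set (closed_simplex K \<sigma>)) (T \<inter> closed_simplex K \<sigma>)"
    then have "\<forall>\<sigma>\<in>K. openin (top_of_set (closed_simplex K \<sigma>))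
        ((S \<inter> closed_simplex K \<sigma>) \<inter> (T \<inter> closed_simplex K \<sigma>))"
      by blast
    moreover have "\<And>C. (S \<inter> C) \<inter> (T \<inter> C) = S \<inter> T \<inter> C" by blast
    ultimately show "S \<inter> T \<subseteq> realization K \<and> (\<forall>\<sigma>\<in>K. openin (top_of_set (closed_simplex K \<sigma>))
        (S \<inter> T \<inter> closed_simplex K \<sigma>))" if "S \<subseteq> realization K"
      using that by auto
  next
    fix \<U>
    assume *: "\<forall>U\<in>\<U>. U \<subseteq> realization K \<and>
      (\<forall>\<sigma>\<in>K. openin (top_of_set (closed_simplex K \<sigma>)) (U \<inter> closed_simplex K \<sigma>))"
    have "openin (top_of_set (closed_simplex K \<sigma>)) (\<Union>\<U> \<inter> closed_simplex K \<sigma>)" if "\<sigma> \<in> K" for \<sigma>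
    proof -
      have "\<Union>\<U> \<inter> closed_simplex K \<sigma> = (\<Union>U\<in>\<U>. U \<inter> closed_simplex K \<sigma>)" by blast
      then show ?thesis using * that by (metis (no_types, lifting) imageE openin_Union)
    qed
    then show "\<Union>\<U> \<subseteq> realization K \<and> (\<forall>\<sigma>\<in>K. openin (top_of_set (closed_simplex K \<sigma>))
        (\<Union>\<U> \<inter> closed_simplex K \<sigma>))"
      using * by auto
  qed
  then show ?thesis
    by (simp add: realization_topology_def)
qed

text \<open>Left multiplication on vertices, extended affinely to the simplices: the coordinate of
  \<open>g \<cdot> \<alpha>\<close> at the vertex \<open>v\<close> is that of \<open>\<alpha>\<close> at \<open>inv g \<otimes> v\<close>.\<close>

definition translation ::
    "('a, 'm) monoid_scheme \<Rightarrow> 'a set set \<Rightarrow> 'a \<Rightarrow> ('a \<Rightarrow> real) \<Rightarrow> 'a \<Rightarrow> real"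
  where "translation G K g = (\<lambda>\<alpha>\<in>realization K.
    \<lambda>v. if v \<in> carrier G then \<alpha> (inv\<^bsub>G\<^esub> g \<otimes>\<^bsub>G\<^esub> v) else 0)"

definition orbit_space ::
    "('a, 'm) monoid_scheme \<Rightarrow> 'x topology \<Rightarrow> ('a \<Rightarrow> 'x \<Rightarrow> 'x) \<Rightarrow> 'x set topology"
  where "orbit_space G X \<phi> = topology (\<lambda>U. U \<subseteq> orbits G (topspace X) \<phi> \<and>
    openin X {x \<in> topspace X. orbit G \<phi> x \<in> U})"

lemma openin_orbit_space:
  "openin (orbit_space G X \<phi>) U \<longleftrightarrow> U \<subseteq> orbits G (topspace X) \<phi> \<and>
    openin X {x \<in> topspace X. orbit G \<phi> x \<in> U}"
proof -
  have "istopology (\<lambda>U. U \<subseteq> orbits G (topspace X) \<phi> \<and>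
    openin X {x \<in> topspace X. orbit G \<phi> x \<in> U})"
    unfolding istopology_def
  proof (rule conjI; clarify)
    fix S T
    assume "S \<subseteq> orbits G (topspace X) \<phi>"
      and "openin X {x \<in> topspace X. orbit G \<phi> x \<in> S}"
      and "openin X {x \<in> topspace X. orbit G \<phi> x \<in> T}"
    moreover have "{x \<in> topspace X. orbit G \<phi> x \<in> S \<inter> T} =
        {x \<in> topspace X. orbit G \<phi> x \<in> S} \<inter> {x \<in> topspace X. orbit G \<phi> x \<in> T}"
      by blast
    ultimately show "S \<inter> T \<subseteq> orbits G (topspace X) \<phi> \<and>
        openin X {x \<in> topspace X. orbit G \<phi> x \<in> S \<inter> T}"
      by auto
  next
    fix \<U>
    assume *: "\<forall>U\<in>\<U>. U \<subseteq> orbits G (topspace X) \<phi> \<and>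
        openin X {x \<in> topspace X. orbit G \<phi> x \<in> U}"
    have "{x \<in> topspace X. orbit G \<phi> x \<in> \<Union>\<U>} =
        (\<Union>U\<in>\<U>. {x \<in> topspace X. orbit G \<phi> x \<in> U})"
      by blast
    then show "\<Union>\<U> \<subseteq> orbits G (topspace X) \<phi> \<and>
        openin X {x \<in> topspace X. orbit G \<phi> x \<in> \<Union>\<U>}"
      using * by (auto intro!: openin_Union)
  qed
  then show ?thesis
    by (simp add: orbit_space_def)
qed

definition garside_action ::
    "('a, 'm) monoid_scheme \<Rightarrow> 'a set \<Rightarrow> 'a \<Rightarrow> ('a \<Rightarrow> real) \<Rightarrow> 'a \<Rightarrow> real"
  where "garside_action G D = translation G (garside_complex G D)"

definition garside_quotient ::
    "('a, 'm) monoid_scheme \<Rightarrow> 'a set \<Rightarrow> ('a \<Rightarrow> real) set topology"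
  where "garside_quotient G D =
    orbit_space G (realization_topology (garside_complex G D)) (garside_action G D)"

text \<open>The \<open>k\<close>-cells of the quotient are the images of the open \<open>k\<close>-simplices.\<close>

definition quotient_cells ::
    "('a, 'm) monoid_scheme \<Rightarrow> 'a set \<Rightarrow> nat \<Rightarrow> ('a \<Rightarrow> real) set set set"
  where "quotient_cells G D k =
    {orbit G (garside_action G D) ` open_simplex (garside_complex G D) \<sigma> | \<sigma>.
      \<sigma> \<in> garside_complex G D \<and> card \<sigma> = Suc k}"

definition open_standard_simplex :: "nat \<Rightarrow> (nat \<Rightarrow> real) set"
  where "open_standard_simplex k = {x \<in> standard_simplex k. \<forall>i\<le>k. 0 < x i}"

text \<open>A \<open>\<Delta>\<close>-complex structure on a space (and hence a CW structure): \<open>A k\<close> indexes the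
  \<open>k\<close>-cells and \<open>\<Phi> k i\<close> is the characteristic map of the cell with index \<open>i\<close>. The open cells
  partition the space, faces of characteristic maps are characteristic maps, and the topology is
  the one determined by the characteristic maps.\<close>

definition delta_complex_structure ::
    "'x topology \<Rightarrow> (nat \<Rightarrow> 'i set) \<Rightarrow> (nat \<Rightarrow> 'i \<Rightarrow> (nat \<Rightarrow> real) \<Rightarrow> 'x) \<Rightarrow> bool"
  where "delta_complex_structure X A \<Phi> \<longleftrightarrow>
    (\<forall>k. \<forall>i\<in>A k. singular_simplex k X (\<Phi> k i) \<and> inj_on (\<Phi> k i) (open_standard_simplex k)) \<and>
    (\<forall>x\<in>topspace X. \<exists>!c. c \<in> Sigma UNIV A \<and> x \<in> \<Phi> (fst c) (snd c) ` open_standard_simplex (fst c)) \<and>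
    (\<forall>k. \<forall>i\<in>A (Suc k). \<forall>j\<le>Suc k. \<exists>i'\<in>A k. singular_face (Suc k) j (\<Phi> (Suc k) i) = \<Phi> k i') \<and>
    (\<forall>U. U \<subseteq> topspace X \<longrightarrow>
      (openin X U \<longleftrightarrow> (\<forall>k. \<forall>i\<in>A k. openin (subtopology (powertop_real UNIV) (standard_simplex k))
        {x \<in> standard_simplex k. \<Phi> k i x \<in> U})))"

text \<open>The cell \<open>[\<mu>\<^sub>1|\<dots>|\<mu>\<^sub>k]\<close>: the image in the quotient of the affine simplex with
  vertices \<open>1, \<mu>\<^sub>1, \<mu>\<^sub>1\<mu>\<^sub>2, \<dots>, \<mu>\<^sub>1\<dots>\<mu>\<^sub>k\<close>, in this order.\<close>

definition bar_cell ::
    "('a, 'm) monoid_scheme \<Rightarrow> 'a set \<Rightarrow> nat \<Rightarrow> 'a list \<Rightarrow> (nat \<Rightarrow> real) \<Rightarrow> ('a \<Rightarrow> real) set"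
  where "bar_cell G D k \<mu>s = (\<lambda>x\<in>standard_simplex k. orbit G (garside_action G D)
    (\<lambda>v. \<Sum>i | i \<le> k \<and> list_product G (take i \<mu>s) = v. x i))"


section \<open>The integral group ring, modules and resolutions\<close>

definition group_ring :: "('a, 'm) monoid_scheme \<Rightarrow> ('a \<Rightarrow>\<^sub>0 int) ring"
  where "group_ring G = \<lparr>carrier = {a. Poly_Mapping.keys a \<subseteq> carrier G},
    monoid.mult = (\<lambda>a b. frag_extend (\<lambda>g. frag_extend (\<lambda>h. frag_of (g \<otimes>\<^bsub>G\<^esub> h)) b) a),
    one = frag_of \<one>\<^bsub>G\<^esub>, ring.zero = 0, ring.add = (+)\<rparr>"

definition augmentation :: "('a \<Rightarrow>\<^sub>0 int) \<Rightarrow> int"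
  where "augmentation a = (\<Sum>g\<in>Poly_Mapping.keys a. Poly_Mapping.lookup a g)"

text \<open>The library locale \<open>module\<close> requires a commutative ring of scalars. As there, the fields
  \<open>mult\<close> and \<open>one\<close> of the record of a module play no role.\<close>

locale left_module = R?: ring R + M?: abelian_group M for R (structure) and M (structure) +
  assumes smult_closed: "\<lbrakk>a \<in> carrier R; x \<in> carrier M\<rbrakk> \<Longrightarrow> a \<odot>\<^bsub>M\<^esub> x \<in> carrier M"
    and smult_l_distr: "\<lbrakk>a \<in> carrier R; b \<in> carrier R; x \<in> carrier M\<rbrakk> \<Longrightarrow>
      (a \<oplus>\<^bsub>R\<^esub> b) \<odot>\<^bsub>M\<^esub> x = a \<odot>\<^bsub>M\<^esub> x \<oplus>\<^bsub>M\<^esub> b \<odot>\<^bsub>M\<^esub> x"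
    and smult_r_distr: "\<lbrakk>a \<in> carrier R; x \<in> carrier M; y \<in> carrier M\<rbrakk> \<Longrightarrow>
      a \<odot>\<^bsub>M\<^esub> (x \<oplus>\<^bsub>M\<^esub> y) = a \<odot>\<^bsub>M\<^esub> x \<oplus>\<^bsub>M\<^esub> a \<odot>\<^bsub>M\<^esub> y"
    and smult_assoc: "\<lbrakk>a \<in> carrier R; b \<in> carrier R; x \<in> carrier M\<rbrakk> \<Longrightarrow>
      (a \<otimes>\<^bsub>R\<^esub> b) \<odot>\<^bsub>M\<^esub> x = a \<odot>\<^bsub>M\<^esub> (b \<odot>\<^bsub>M\<^esub> x)"
    and smult_one: "x \<in> carrier M \<Longrightarrow> \<one>\<^bsub>R\<^esub> \<odot>\<^bsub>M\<^esub> x = x"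

definition module_homs ::
    "('r, 's) ring_scheme \<Rightarrow> ('r, 'x, 'm) module_scheme \<Rightarrow> ('r, 'y, 'n) module_scheme \<Rightarrow> ('x \<Rightarrow> 'y) set"
  where "module_homs R M N = {f \<in> carrier M \<rightarrow> carrier N.
    (\<forall>x\<in>carrier M. \<forall>y\<in>carrier M. f (x \<oplus>\<^bsub>M\<^esub> y) = f x \<oplus>\<^bsub>N\<^esub> f y) \<and>
    (\<forall>a\<in>carrier R. \<forall>x\<in>carrier M. f (a \<odot>\<^bsub>M\<^esub> x) = a \<odot>\<^bsub>N\<^esub> f x)}"

definition free_module :: "('r, 's) ring_scheme \<Rightarrow> nat \<Rightarrow> ('r, nat \<Rightarrow> 'r) module"
  where "free_module R n = \<lparr>carrier = {..<n} \<rightarrow>\<^sub>E carrier R,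
    monoid.mult = (\<lambda>x y. \<lambda>i\<in>{..<n}. x i \<otimes>\<^bsub>R\<^esub> y i), one = (\<lambda>i\<in>{..<n}. \<one>\<^bsub>R\<^esub>),
    ring.zero = (\<lambda>i\<in>{..<n}. \<zero>\<^bsub>R\<^esub>), ring.add = (\<lambda>x y. \<lambda>i\<in>{..<n}. x i \<oplus>\<^bsub>R\<^esub> y i),
    smult = (\<lambda>a x. \<lambda>i\<in>{..<n}. a \<otimes>\<^bsub>R\<^esub> x i)\<rparr>"

text \<open>The integers, every group element acting as the identity.\<close>

definition trivial_module :: "('a \<Rightarrow>\<^sub>0 int, int) module"
  where "trivial_module = \<lparr>carrier = UNIV, monoid.mult = (*), one = 1, ring.zero = 0, ring.add = (+),
    smult = (\<lambda>a n. augmentation a * n)\<rparr>"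

text \<open>Exactness of \<open>\<dots> \<rightarrow> F 2 \<rightarrow> F 1 \<rightarrow> F 0 \<rightarrow> N \<rightarrow> 0\<close>, where \<open>\<delta> k\<close> maps \<open>F (k + 1)\<close> to \<open>F k\<close> and
  \<open>\<epsilon>\<close> maps \<open>F 0\<close> to \<open>N\<close>.\<close>

definition left_resolution ::
    "('r, 's) ring_scheme \<Rightarrow> (nat \<Rightarrow> ('r, 'x, 'm) module_scheme) \<Rightarrow> (nat \<Rightarrow> 'x \<Rightarrow> 'x) \<Rightarrow>
      ('r, 'y, 'n) module_scheme \<Rightarrow> ('x \<Rightarrow> 'y) \<Rightarrow> bool"
  where "left_resolution R F \<delta> N \<epsilon> \<longleftrightarrow>
    left_module R N \<and> (\<forall>k. left_module R (F k)) \<and>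
    \<epsilon> \<in> module_homs R (F 0) N \<and> (\<forall>k. \<delta> k \<in> module_homs R (F (Suc k)) (F k)) \<and>
    \<epsilon> ` carrier (F 0) = carrier N \<and>
    a_kernel (F 0) N \<epsilon> = \<delta> 0 ` carrier (F 1) \<and>
    (\<forall>k. a_kernel (F (Suc k)) (F k) (\<delta> k) = \<delta> (Suc k) ` carrier (F (Suc (Suc k))))"

end

theory Submission
  imports Defs
begin

text \<open>
  The Cayley graph carries the order \<open>v \<le> w \<longleftrightarrow> inv v \<otimes> w \<in> P\<close>, which is invariant under left
  translation, and two vertices are adjacent iff they differ by a nontrivial simple element. A clique
  is therefore totally ordered; reading off its steps \<open>\<mu>\<^sub>1, \<dots>, \<mu>\<^sub>k\<close> from its least vertex \<open>g\<close> gives a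
  tuple whose product is simple, and \<open>g\<close> and the tuple determine the clique. Hence the simplices are
  \<open>G\<close> times the tuples, with \<open>G\<close> acting freely on the first factor and respecting the order of the
  vertices (\<open>mem_garside_complex\<close>, \<open>simple_chain_eq_verts\<close>, \<open>map_translate_verts_eqD\<close>). The
  statements on the quotient follow: orbits of points in open simplices correspond to tuples
  together with barycentric coordinates (\<open>bar_cell_eqD\<close>, \<open>realization_point\<close>), and barycentric coordinates
  identify each closed simplex with a standard simplex topologically.

  The same description makes the ordered simplicial chain complex a complex of free
  \<open>\<int>G\<close>-modules with the tuples as bases, so only its acyclicity remains (\<open>cycle_is_boundary\<close>). A cycle
  has finite support, and finitely many vertices have an upper bound \<open>g\<close>. Build the part of the
  complex below \<open>g\<close> by adding vertices in order of increasing distance from \<open>g\<close>. When a vertex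
  \<open>v \<noteq> g\<close> is added, it is attached along the vertices \<open>v \<otimes> t\<close> where \<open>t\<close> is a nontrivial simple left
  divisor of \<open>inv v \<otimes> g\<close>; since there is a greatest such \<open>t\<close>, its link is a cone
  (\<open>greatest_neighbour_exists\<close>). Coning off in every link gives a map that is a contracting homotopy
  up to terms closer to \<open>g\<close> (\<open>contraction_defect\<close>), and induction on the distance finishes the
  argument.

  The length function of the monoid serves as the distance. It also bounds the dimension: a
  product of \<open>k\<close> nontrivial simple elements has length at least \<open>k\<close>.
\<close>

section \<open>Divisibility in a Garside monoid\<close>

lemma list_product_simps [simp]:
  "list_product M [] = \<one>\<^bsub>M\<^esub>"
  "list_product M (a # as) = a \<otimes>\<^bsub>M\<^esub> list_product M as"
  by (simp_all add: list_product_def)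

lemma (in monoid) list_product_closed:
  "set as \<subseteq> carrier G \<Longrightarrow> list_product G as \<in> carrier G"
  by (induction as) auto

lemma (in monoid) list_product_append:
  "\<lbrakk>set as \<subseteq> carrier G; set bs \<subseteq> carrier G\<rbrakk> \<Longrightarrow>
    list_product G (as @ bs) = list_product G as \<otimes> list_product G bs"
  by (induction as) (auto simp: list_product_closed m_assoc)

lemma list_product_carrier_update [simp]: "list_product (G\<lparr>carrier := P\<rparr>) as = list_product G as"
  by (simp add: list_product_def)

text \<open>Putting the atoms of \<open>a\<close> in front lengthens every factorization of \<open>b\<close>. As the lengths of the
  factorizations of the product are bounded, the inequality between the suprema is strict.\<close>

lemma atom_length_less:
  assumes M: "atomic_monoid M" and a: "a \<in> carrier M" "a \<noteq> \<one>\<^bsub>M\<^esub>" and b: "b \<in> carrier M"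
  shows "atom_length M b < atom_length M (a \<otimes>\<^bsub>M\<^esub> b)"
proof -
  interpret monoid M using M by (simp add: atomic_monoid_def)
  have ind: "Collect (indivisible M) \<subseteq> carrier M" by (auto simp: indivisible_def)
  obtain n where n: "atom_length M (a \<otimes>\<^bsub>M\<^esub> b) = enat n"
    using M a b unfolding atomic_monoid_def by (metis enat_ord_simps(4) m_closed not_infinity_eq)
  have gen: "\<exists>as. set as \<subseteq> Collect (indivisible M) \<and> list_product M as = m" if "m \<in> carrier M" for m
    using M that unfolding atomic_monoid_def monoid_generated_by_def by blast
  obtain as where as: "set as \<subseteq> Collect (indivisible M)" "list_product M as = a"
    using gen a by blast
  have "as \<noteq> []" using as a by auto
  have le: "Suc (length bs) \<le> n"
    if bs: "set bs \<subseteq> Collect (indivisible M)" "list_product M bs = b" for bs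
  proof -
    have "list_product M (as @ bs) = a \<otimes>\<^bsub>M\<^esub> b"
      using list_product_append[of as bs] as bs ind by auto
    then have "enat (length (as @ bs)) \<le> atom_length M (a \<otimes>\<^bsub>M\<^esub> b)"
      unfolding atom_length_def using as bs by (intro SUP_upper) auto
    then show ?thesis using n \<open>as \<noteq> []\<close> by (cases as) auto
  qed
  have "atom_length M b \<le> enat (n - 1)"
    unfolding atom_length_def
  proof (rule SUP_least)
    fix bs assume "bs \<in> {as. set as \<subseteq> Collect (indivisible M) \<and> list_product M as = b}"
    then show "enat (length bs) \<le> enat (n - 1)" using le[of bs] by auto
  qed
  moreover have "n > 0" using gen[OF b] le by fastforce
  ultimately show ?thesis
    unfolding n using le_less_trans[of "atom_length M b" "enat (n - 1)" "enat n"] by simp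
qed

lemma divides_submonoid:
  "a divides\<^bsub>G\<lparr>carrier := P\<rparr>\<^esub> b \<longleftrightarrow> (\<exists>c\<in>P. b = a \<otimes>\<^bsub>G\<^esub> c)"
  by (simp add: factor_def)

lemma divides_opposite_submonoid:
  "a divides\<^bsub>opposite (G\<lparr>carrier := P\<rparr>)\<^esub> b \<longleftrightarrow> (\<exists>c\<in>P. b = c \<otimes>\<^bsub>G\<^esub> a)"
  by (simp add: factor_def opposite_def)

text \<open>The part of the structure of a Garside group on which the topology and the algebra rest.
  The order on \<open>G\<close> is \<open>v \<le> w \<longleftrightarrow> inv v \<otimes> w \<in> P\<close>, it is invariant under left translation, and \<open>len\<close>
  measures the distance between comparable elements. The last assumption says that finite
  sets have upper bounds; the one before it provides the greatest simple left divisor of an element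
  of \<open>P\<close>.\<close>

locale garside_order = group G for G (structure) +
  fixes P D :: "'a set" and len :: "'a \<Rightarrow> nat"
  assumes P_carrier: "P \<subseteq> carrier G"
    and P_one: "\<one> \<in> P"
    and P_mult: "\<lbrakk>a \<in> P; b \<in> P\<rbrakk> \<Longrightarrow> a \<otimes> b \<in> P"
    and D_P: "D \<subseteq> P"
    and D_one: "\<one> \<in> D"
    and D_finite: "finite D"
    and D_left: "\<lbrakk>a \<in> P; b \<in> P; a \<otimes> b \<in> D\<rbrakk> \<Longrightarrow> a \<in> D"
    and D_right: "\<lbrakk>a \<in> P; b \<in> P; a \<otimes> b \<in> D\<rbrakk> \<Longrightarrow> b \<in> D"
    and len_less: "\<lbrakk>a \<in> P; b \<in> P; a \<noteq> \<one>\<rbrakk> \<Longrightarrow> len b < len (a \<otimes> b)"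
    and greatest_simple: "p \<in> P \<Longrightarrow> \<exists>s\<in>D. (\<exists>q\<in>P. p = s \<otimes> q) \<and>
      (\<forall>t\<in>D. (\<exists>q\<in>P. p = t \<otimes> q) \<longrightarrow> (\<exists>r\<in>P. s = t \<otimes> r)) \<and> (p \<noteq> \<one> \<longrightarrow> s \<noteq> \<one>)"
    and bounded: "\<lbrakk>finite X; X \<subseteq> carrier G\<rbrakk> \<Longrightarrow> \<exists>g\<in>carrier G. \<forall>v\<in>X. inv v \<otimes> g \<in> P"

text \<open>That \<open>D\<close> consists of both the left and the right divisors of \<open>\<Delta>\<close> makes it closed under both
  kinds of factors. The greatest simple left divisor of \<open>p\<close> is the greatest common divisor of \<open>p\<close> and
  \<open>\<Delta>\<close>, and it is nontrivial because \<open>D\<close> generates. Upper bounds come from least common multiples of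
  numerators.\<close>

lemma garside_order_of_garside_group:
  assumes GP: "garside_group G P"
    and \<Delta>: "garside_element (G\<lparr>carrier := P\<rparr>) \<Delta>"
    and D: "D = simple_divisors (G\<lparr>carrier := P\<rparr>) \<Delta>"
  shows "garside_order G P D (\<lambda>m. the_enat (atom_length (G\<lparr>carrier := P\<rparr>) m))"
proof -
  let ?M = "G\<lparr>carrier := P\<rparr>"
  interpret group G using GP by (simp add: garside_group_def)
  interpret S: submonoid P G using GP by (simp add: garside_group_def)
  have atomic: "atomic_monoid ?M" and gl: "has_gcds_lcms ?M"
    using GP unfolding garside_group_def garside_monoid_def by auto
  have P[simp]: "a \<in> P \<Longrightarrow> a \<in> carrier G" for a using S.subset by blast
  have \<Delta>P: "\<Delta> \<in> P" using \<Delta> by (simp add: garside_element_def)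
  have Dl: "a \<in> D \<longleftrightarrow> a \<in> P \<and> (\<exists>c\<in>P. \<Delta> = a \<otimes>\<^bsub>G\<^esub> c)" for a
    unfolding D simple_divisors_def left_divisors_def by (simp add: divides_submonoid)
  have Dr: "a \<in> D \<longleftrightarrow> a \<in> P \<and> (\<exists>c\<in>P. \<Delta> = c \<otimes>\<^bsub>G\<^esub> a)" for a
    using \<Delta> unfolding D simple_divisors_def garside_element_def right_divisors_def
    by (simp add: divides_opposite_submonoid)
  have lf: "atom_length ?M m < \<infinity>" if "m \<in> P" for m
    using atomic that by (simp add: atomic_monoid_def)
  have len: "the_enat (atom_length ?M b) < the_enat (atom_length ?M (a \<otimes>\<^bsub>G\<^esub> b))"
    if "a \<in> P" "b \<in> P" "a \<noteq> \<one>\<^bsub>G\<^esub>" for a b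
    using atom_length_less[OF atomic, of a b] that lf[of b] lf[of "a \<otimes>\<^bsub>G\<^esub> b"]
    by (cases "atom_length ?M b"; cases "atom_length ?M (a \<otimes>\<^bsub>G\<^esub> b)") auto
  have no_units: "a = \<one>\<^bsub>G\<^esub>" if "a \<in> P" "b \<in> P" "a \<otimes>\<^bsub>G\<^esub> b = \<one>\<^bsub>G\<^esub>" for a b
  proof (rule ccontr)
    assume a: "a \<noteq> \<one>\<^bsub>G\<^esub>"
    then have "b \<noteq> \<one>\<^bsub>G\<^esub>" using that by auto
    then show False using len[of a b] len[of b "\<one>\<^bsub>G\<^esub>"] that a by simp
  qed
  have first: "\<exists>t\<in>D - {\<one>\<^bsub>G\<^esub>}. \<exists>q\<in>P. p = t \<otimes>\<^bsub>G\<^esub> q" if "p \<in> P" "p \<noteq> \<one>\<^bsub>G\<^esub>" for p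
  proof -
    obtain as where "set as \<subseteq> D" "list_product G as = p"
      using \<Delta> \<open>p \<in> P\<close> unfolding garside_element_def monoid_generated_by_def D simple_divisors_def
      by auto
    then show ?thesis using \<open>p \<noteq> \<one>\<^bsub>G\<^esub>\<close>
    proof (induction as arbitrary: p)
      case (Cons a as)
      have as: "list_product G as \<in> P" using Cons.prems(1) Dl by (induction as) auto
      show ?case
      proof (cases "a = \<one>\<^bsub>G\<^esub>")
        case True
        then have "list_product G as = p" using Cons.prems as by simp
        then show ?thesis using Cons by simp
      next
        case False
        then show ?thesis using Cons.prems as by auto
      qed
    qed simp
  qed
  show ?thesis
  proof unfold_locales
    show "P \<subseteq> carrier G" "\<one>\<^bsub>G\<^esub> \<in> P" using S.subset by auto
    show "\<And>a b. \<lbrakk>a \<in> P; b \<in> P\<rbrakk> \<Longrightarrow> a \<otimes>\<^bsub>G\<^esub> b \<in> P" by simp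
    show "D \<subseteq> P" using Dl by blast
    show "\<one>\<^bsub>G\<^esub> \<in> D" unfolding Dl using \<Delta>P by auto
    show "finite D" using \<Delta> unfolding D garside_element_def simple_divisors_def by (elim conjE)
    show "\<And>a b. \<lbrakk>a \<in> P; b \<in> P; a \<otimes>\<^bsub>G\<^esub> b \<in> D\<rbrakk> \<Longrightarrow> a \<in> D"
      unfolding Dl by (metis P S.m_closed m_assoc)
    show "\<And>a b. \<lbrakk>a \<in> P; b \<in> P; a \<otimes>\<^bsub>G\<^esub> b \<in> D\<rbrakk> \<Longrightarrow> b \<in> D"
      unfolding Dr by (metis P S.m_closed m_assoc)
    show "\<And>a b. \<lbrakk>a \<in> P; b \<in> P; a \<noteq> \<one>\<^bsub>G\<^esub>\<rbrakk> \<Longrightarrow> the_enat (atom_length ?M b)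
        < the_enat (atom_length ?M (a \<otimes>\<^bsub>G\<^esub> b))" by (rule len)
  next
    fix p assume p: "p \<in> P"
    obtain s where s: "s \<in> P" "s gcdof\<^bsub>?M\<^esub> p \<Delta>"
      using gl p \<Delta>P unfolding has_gcds_lcms_def by auto
    then have sd: "\<exists>q\<in>P. p = s \<otimes>\<^bsub>G\<^esub> q" "s \<in> D"
      and max: "\<And>t. \<lbrakk>t \<in> D; \<exists>q\<in>P. p = t \<otimes>\<^bsub>G\<^esub> q\<rbrakk> \<Longrightarrow> \<exists>r\<in>P. s = t \<otimes>\<^bsub>G\<^esub> r"
      unfolding isgcd_def Dl divides_submonoid by auto
    have "s \<noteq> \<one>\<^bsub>G\<^esub>" if "p \<noteq> \<one>\<^bsub>G\<^esub>"
    proof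
      assume s1: "s = \<one>\<^bsub>G\<^esub>"
      obtain t where t: "t \<in> D - {\<one>\<^bsub>G\<^esub>}" "\<exists>q\<in>P. p = t \<otimes>\<^bsub>G\<^esub> q" using first[OF p \<open>p \<noteq> \<one>\<^bsub>G\<^esub>\<close>] by auto
      with max[of t] obtain r where r: "r \<in> P" "s = t \<otimes>\<^bsub>G\<^esub> r" by auto
      have "t \<in> P" using t Dl by auto
      moreover have "t \<otimes>\<^bsub>G\<^esub> r = \<one>\<^bsub>G\<^esub>" using r(2) s1 by metis
      ultimately show False using no_units r(1) t(1) by blast
    qed
    then show "\<exists>s\<in>D. (\<exists>q\<in>P. p = s \<otimes>\<^bsub>G\<^esub> q) \<and>
      (\<forall>t\<in>D. (\<exists>q\<in>P. p = t \<otimes>\<^bsub>G\<^esub> q) \<longrightarrow> (\<exists>r\<in>P. s = t \<otimes>\<^bsub>G\<^esub> r)) \<and> (p \<noteq> \<one>\<^bsub>G\<^esub> \<longrightarrow> s \<noteq> \<one>\<^bsub>G\<^esub>)"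
      using sd max by blast
  next
    fix X assume "finite X" "X \<subseteq> carrier G"
    then have "\<exists>g\<in>P. \<forall>v\<in>X. inv\<^bsub>G\<^esub> v \<otimes>\<^bsub>G\<^esub> g \<in> P"
    proof (induction X)
      case empty
      show ?case using S.one_closed by blast
    next
      case (insert v X)
      then obtain g where g: "g \<in> P" "\<And>w. w \<in> X \<Longrightarrow> inv\<^bsub>G\<^esub> w \<otimes>\<^bsub>G\<^esub> g \<in> P" by auto
      obtain a b where ab: "a \<in> P" "b \<in> P" "v = a \<otimes>\<^bsub>G\<^esub> inv\<^bsub>G\<^esub> b"
        using GP insert.prems unfolding garside_group_def by auto
      \<comment> \<open>The numerator \<open>a\<close> is an upper bound of the fraction \<open>v = a / b\<close>.\<close>
      have va: "inv\<^bsub>G\<^esub> v \<otimes>\<^bsub>G\<^esub> a = b" using ab by (simp add: inv_mult_group m_assoc)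
      obtain h where "h \<in> P" "h lcmof\<^bsub>?M\<^esub> a g"
        using gl g(1) ab(1) unfolding has_gcds_lcms_def by fastforce
      then obtain r s where rs: "r \<in> P" "s \<in> P" "h = a \<otimes>\<^bsub>G\<^esub> r" "h = g \<otimes>\<^bsub>G\<^esub> s" "h \<in> P"
        unfolding islcm_def divides_submonoid by auto
      have "inv\<^bsub>G\<^esub> v \<otimes>\<^bsub>G\<^esub> h = b \<otimes>\<^bsub>G\<^esub> r"
        using va rs(1,3) ab insert.prems by (metis P inv_closed insert_subset m_assoc)
      moreover have "inv\<^bsub>G\<^esub> w \<otimes>\<^bsub>G\<^esub> h \<in> P" if "w \<in> X" for w
      proof -
        have "inv\<^bsub>G\<^esub> w \<otimes>\<^bsub>G\<^esub> h = (inv\<^bsub>G\<^esub> w \<otimes>\<^bsub>G\<^esub> g) \<otimes>\<^bsub>G\<^esub> s"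
          using that insert.prems g(1) rs by (simp add: m_assoc subset_iff)
        then show ?thesis using g(2)[OF that] rs by simp
      qed
      ultimately show ?case using rs ab by (intro bexI[of _ h]) auto
    qed
    then show "\<exists>g\<in>carrier G. \<forall>v\<in>X. inv\<^bsub>G\<^esub> v \<otimes>\<^bsub>G\<^esub> g \<in> P" by auto
  qed
qed


section \<open>Chains of the divisibility order\<close>

context garside_order
begin

lemma P_closed [simp]: "a \<in> P \<Longrightarrow> a \<in> carrier G"
  using P_carrier by blast

lemma D_closed [simp]: "a \<in> D \<Longrightarrow> a \<in> carrier G"
  using D_P by auto

text \<open>Otherwise multiplication by \<open>b\<close> and then by \<open>a\<close> would return to the same element with a greater
  length.\<close>

lemma left_unit_eq_one:
  assumes "a \<in> P" "b \<in> P" "a \<otimes> b = \<one>"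
  shows "a = \<one>"
proof (rule ccontr)
  assume a: "a \<noteq> \<one>"
  then have "b \<noteq> \<one>" using assms by auto
  then show False using len_less[of a b] len_less[of b "\<one>"] assms a P_one by simp
qed

text \<open>Adjacency in the Cayley graph, directed upwards in the order of \<open>G\<close>.\<close>

definition prec :: "'a \<Rightarrow> 'a \<Rightarrow> bool"  (infix \<open>\<triangleleft>\<close> 50)
  where "v \<triangleleft> w \<longleftrightarrow> inv v \<otimes> w \<in> D - {\<one>}"

text \<open>The relation \<open>\<triangleleft>\<close> is not transitive, so a chain asks for it between any two of its members.
  Thus sublists of chains are chains.\<close>

definition simple_chain :: "'a list \<Rightarrow> bool"
  where "simple_chain vs \<longleftrightarrow> set vs \<subseteq> carrier G \<and> sorted_wrt (\<triangleleft>) vs"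

lemma simple_chain_Nil [simp]: "simple_chain []"
  by (simp add: simple_chain_def)

lemma simple_chain_Cons:
  "simple_chain (v # vs) \<longleftrightarrow> v \<in> carrier G \<and> (\<forall>w\<in>set vs. v \<triangleleft> w) \<and> simple_chain vs"
  by (auto simp: simple_chain_def)

lemma inv_mult_cancel [simp]:
  assumes "h \<in> carrier G" "w \<in> carrier G"
  shows "inv h \<otimes> (h \<otimes> w) = w" "h \<otimes> (inv h \<otimes> w) = w"
  using assms by (simp_all add: m_assoc[symmetric])

lemma inv_mult_telescope:
  "\<lbrakk>u \<in> carrier G; v \<in> carrier G; w \<in> carrier G\<rbrakk> \<Longrightarrow> (inv u \<otimes> v) \<otimes> (inv v \<otimes> w) = inv u \<otimes> w"
  by (simp add: m_assoc)

lemma inv_mult_translate: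
  "\<lbrakk>h \<in> carrier G; v \<in> carrier G; w \<in> carrier G\<rbrakk> \<Longrightarrow> inv (h \<otimes> v) \<otimes> (h \<otimes> w) = inv v \<otimes> w"
  by (simp add: inv_mult_group m_assoc)

lemma prec_irrefl: "v \<in> carrier G \<Longrightarrow> \<not> v \<triangleleft> v"
  by (simp add: prec_def)

lemma strict_P_trans:
  assumes "u \<in> carrier G" "v \<in> carrier G" "w \<in> carrier G"
    and "inv u \<otimes> v \<in> P - {\<one>}" "inv v \<otimes> w \<in> P - {\<one>}"
  shows "inv u \<otimes> w \<in> P - {\<one>}"
  using inv_mult_telescope[OF assms(1-3)] P_mult[of "inv u \<otimes> v" "inv v \<otimes> w"]
    left_unit_eq_one[of "inv u \<otimes> v" "inv v \<otimes> w"] assms(4,5) by auto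

lemma strict_P_asym:
  assumes "v \<in> carrier G" "w \<in> carrier G" "inv v \<otimes> w \<in> P - {\<one>}"
  shows "inv w \<otimes> v \<notin> P - {\<one>}"
  using strict_P_trans[of v w v] assms by auto

lemma prec_strict_P: "v \<triangleleft> w \<Longrightarrow> inv v \<otimes> w \<in> P - {\<one>}"
  using D_P by (auto simp: prec_def)

lemma prec_asym: "\<lbrakk>v \<in> carrier G; w \<in> carrier G; v \<triangleleft> w\<rbrakk> \<Longrightarrow> \<not> w \<triangleleft> v"
  using strict_P_asym prec_strict_P by blast

lemma prec_translate:
  "\<lbrakk>h \<in> carrier G; v \<in> carrier G; w \<in> carrier G\<rbrakk> \<Longrightarrow> h \<otimes> v \<triangleleft> h \<otimes> w \<longleftrightarrow> v \<triangleleft> w"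
  by (simp add: prec_def inv_mult_translate)

lemma simple_chain_translate:
  assumes "h \<in> carrier G" "simple_chain vs"
  shows "simple_chain (map (\<lambda>v. h \<otimes> v) vs)"
  using assms(2) by (induction vs) (use assms(1) in \<open>auto simp: simple_chain_Cons simple_chain_def prec_translate\<close>)

lemma simple_chain_distinct: "simple_chain vs \<Longrightarrow> distinct vs"
  by (induction vs) (auto simp: simple_chain_Cons prec_irrefl)

lemma simple_chain_sublist:
  assumes "simple_chain (us @ vs @ ws)"
  shows "simple_chain (us @ ws)"
  using assms by (auto simp: simple_chain_def sorted_wrt_append)

text \<open>A chain is determined by its vertex set, so that simplices may be replaced by chains.\<close>

lemma simple_chain_unique:
  assumes "simple_chain vs" "simple_chain ws" "set vs = set ws"
  shows "vs = ws"
  using assms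
proof (induction vs arbitrary: ws)
  case (Cons v vs)
  then obtain w ws' where ws: "ws = w # ws'" by (cases ws) auto
  have car: "v \<in> carrier G" "w \<in> carrier G" using Cons.prems ws by (auto simp: simple_chain_def)
  have vw: "v = w"
  proof (rule ccontr)
    assume ne: "v \<noteq> w"
    then have "v \<in> set ws'" "w \<in> set vs" using Cons.prems(3) ws by auto
    then have "w \<triangleleft> v" "v \<triangleleft> w" using Cons.prems ws by (auto simp: simple_chain_Cons)
    then show False using prec_asym car by blast
  qed
  have "set vs = set ws'"
    using Cons.prems ws vw simple_chain_distinct[of "v # vs"] simple_chain_distinct[of ws] by auto
  then show ?case using Cons.IH[of ws'] Cons.prems ws vw by (simp add: simple_chain_Cons)
qed simp

text \<open>A clique of the graph is totally ordered by \<open>\<triangleleft>\<close>; splitting off minimal elements sorts it.\<close>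

lemma clique_is_simple_chain:
  assumes "finite \<sigma>" "\<sigma> \<subseteq> carrier G" "\<And>v w. \<lbrakk>v \<in> \<sigma>; w \<in> \<sigma>; v \<noteq> w\<rbrakk> \<Longrightarrow> v \<triangleleft> w \<or> w \<triangleleft> v"
  shows "\<exists>vs. simple_chain vs \<and> set vs = \<sigma>"
  using assms
proof (induction \<sigma> rule: finite_psubset_induct)
  case (psubset \<sigma>)
  show ?case
  proof (cases "\<sigma> = {}")
    case True
    then show ?thesis by (intro exI[of _ "[]"]) simp
  next
    case False
    let ?R = "\<lambda>v w. inv v \<otimes> w \<in> P - {\<one>}"
    have car: "\<And>v. v \<in> \<sigma> \<Longrightarrow> v \<in> carrier G" using psubset.prems by blast
    have "asymp_on \<sigma> ?R" using car strict_P_asym by (intro asymp_onI) blast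
    moreover have "transp_on \<sigma> ?R" using car strict_P_trans by (intro transp_onI) blast
    ultimately obtain m where m: "m \<in> \<sigma>" "\<forall>x\<in>\<sigma>. x \<noteq> m \<longrightarrow> \<not> ?R x m"
      using Finite_Set.bex_min_element[OF psubset.hyps(1), of ?R] False by blast
    have mlt: "m \<triangleleft> x" if "x \<in> \<sigma>" "x \<noteq> m" for x
      using psubset.prems(2)[OF m(1) that(1)] m(2) that prec_strict_P by blast
    obtain vs where vs: "simple_chain vs" "set vs = \<sigma> - {m}"
      using psubset.IH[of "\<sigma> - {m}"] psubset.prems m(1) by blast
    then have "simple_chain (m # vs)" using mlt car[OF m(1)] by (auto simp: simple_chain_Cons)
    then show ?thesis using vs m(1) by (intro exI[of _ "m # vs"]) auto
  qed
qed

lemma mem_cayley_edges: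
  assumes "v \<in> carrier G" "w \<in> carrier G" "v \<noteq> w"
  shows "{v, w} \<in> cayley_edges G D \<longleftrightarrow> v \<triangleleft> w \<or> w \<triangleleft> v"
proof
  assume "{v, w} \<in> cayley_edges G D"
  then obtain g \<mu> where "g \<in> carrier G" "\<mu> \<in> D - {\<one>}" "{v, w} = {g, g \<otimes> \<mu>}"
    unfolding cayley_edges_def by blast
  then have "inv g \<otimes> (g \<otimes> \<mu>) \<in> D - {\<one>}" "v = g \<and> w = g \<otimes> \<mu> \<or> w = g \<and> v = g \<otimes> \<mu>"
    using inv_mult_translate[of g \<one> \<mu>] by (auto simp: doubleton_eq_iff)
  then show "v \<triangleleft> w \<or> w \<triangleleft> v" unfolding prec_def by auto
next
  have edge: "{x, y} \<in> cayley_edges G D" if "x \<in> carrier G" "y \<in> carrier G" "x \<triangleleft> y" for x y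
    unfolding cayley_edges_def using that
    by (intro CollectI exI[of _ x] exI[of _ "inv x \<otimes> y"]) (simp add: prec_def)
  assume "v \<triangleleft> w \<or> w \<triangleleft> v"
  then show "{v, w} \<in> cayley_edges G D" using edge assms by (metis insert_commute)
qed

lemma mem_garside_complex:
  "\<sigma> \<in> garside_complex G D \<longleftrightarrow> (\<exists>vs. simple_chain vs \<and> vs \<noteq> [] \<and> \<sigma> = set vs)"
proof
  assume s: "\<sigma> \<in> garside_complex G D"
  then have f: "finite \<sigma>" "\<sigma> \<noteq> {}" and car: "\<sigma> \<subseteq> carrier G"
    and e: "\<And>v w. \<lbrakk>v \<in> \<sigma>; w \<in> \<sigma>; v \<noteq> w\<rbrakk> \<Longrightarrow> {v, w} \<in> cayley_edges G D"
    by (auto simp: garside_complex_def flag_complex_def)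
  have "\<exists>vs. simple_chain vs \<and> set vs = \<sigma>"
  proof (rule clique_is_simple_chain[OF f(1) car])
    fix v w assume "v \<in> \<sigma>" "w \<in> \<sigma>" "v \<noteq> w"
    then show "v \<triangleleft> w \<or> w \<triangleleft> v" using e[of v w] mem_cayley_edges[of v w] car by auto
  qed
  then show "\<exists>vs. simple_chain vs \<and> vs \<noteq> [] \<and> \<sigma> = set vs" using f by auto
next
  assume "\<exists>vs. simple_chain vs \<and> vs \<noteq> [] \<and> \<sigma> = set vs"
  then obtain vs where vs: "simple_chain vs" "vs \<noteq> []" "\<sigma> = set vs" by blast
  have car: "set vs \<subseteq> carrier G" using vs by (simp add: simple_chain_def)
  have "v \<triangleleft> w \<or> w \<triangleleft> v" if "v \<in> set vs" "w \<in> set vs" "v \<noteq> w" for v w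
    using vs(1) that by (induction vs) (auto simp: simple_chain_Cons)
  then show "\<sigma> \<in> garside_complex G D"
    using vs(2,3) car mem_cayley_edges by (auto simp: garside_complex_def flag_complex_def subset_iff)
qed

text \<open>Passing between chains and pairs of a least vertex and the quotients of successive vertices; the
  next lemmas show that the two maps are mutually inverse.\<close>

primrec verts :: "'a \<Rightarrow> 'a list \<Rightarrow> 'a list"
  where "verts g [] = [g]"
  | "verts g (\<mu> # \<mu>s) = g # verts (g \<otimes> \<mu>) \<mu>s"

fun steps :: "'a list \<Rightarrow> 'a list"
  where "steps (v # w # vs) = (inv v \<otimes> w) # steps (w # vs)"
  | "steps vs = []"

lemma length_verts [simp]: "length (verts g \<mu>s) = Suc (length \<mu>s)"
  by (induction \<mu>s arbitrary: g) auto

lemma verts_not_Nil [simp]: "verts g \<mu>s \<noteq> []"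
  by (cases \<mu>s) auto

lemma hd_verts [simp]: "hd (verts g \<mu>s) = g"
  by (cases \<mu>s) auto

lemma length_steps: "length (steps vs) = length vs - 1"
  by (induction vs rule: steps.induct) auto

lemma nth_verts:
  assumes "g \<in> carrier G" "set \<mu>s \<subseteq> carrier G" "i \<le> length \<mu>s"
  shows "verts g \<mu>s ! i = g \<otimes> list_product G (take i \<mu>s)"
  using assms
proof (induction \<mu>s arbitrary: g i)
  case (Cons \<mu> \<mu>s)
  have "set (take j \<mu>s) \<subseteq> carrier G" for j
    using Cons.prems set_take_subset[of j \<mu>s] by auto
  then show ?case
    using Cons by (cases i) (auto simp: m_assoc list_product_closed)
qed simp

lemma map_translate_verts:
  assumes "h \<in> carrier G" "g \<in> carrier G" "set \<mu>s \<subseteq> carrier G"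
  shows "map (\<lambda>v. h \<otimes> v) (verts g \<mu>s) = verts (h \<otimes> g) \<mu>s"
  using assms by (induction \<mu>s arbitrary: g) (auto simp: m_assoc)

lemma steps_verts:
  assumes "g \<in> carrier G" "set \<mu>s \<subseteq> carrier G"
  shows "steps (verts g \<mu>s) = \<mu>s"
  using assms
proof (induction \<mu>s arbitrary: g)
  case (Cons \<mu> \<mu>s)
  have "steps (g # verts (g \<otimes> \<mu>) \<mu>s) = (inv g \<otimes> (g \<otimes> \<mu>)) # steps (verts (g \<otimes> \<mu>) \<mu>s)"
    by (cases \<mu>s) auto
  then show ?case using Cons by simp
qed simp

lemma verts_steps:
  assumes "set vs \<subseteq> carrier G" "vs \<noteq> []"
  shows "verts (hd vs) (steps vs) = vs"
  using assms by (induction vs rule: steps.induct) auto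

lemma list_product_steps:
  assumes "set (v # vs) \<subseteq> carrier G"
  shows "list_product G (steps (v # vs)) = inv v \<otimes> last (v # vs)"
  using assms
proof (induction vs arbitrary: v)
  case (Cons w vs)
  then have "last (w # vs) \<in> carrier G" 
    using subsetD[OF Cons.prems, of "last (w # vs)"] last_in_set[of "w # vs"] by simp
  then show ?case using Cons by (simp add: inv_mult_telescope)
qed simp

lemma simple_tuplesD:
  assumes "\<mu>s \<in> simple_tuples G D k"
  shows "length \<mu>s = k" "set \<mu>s \<subseteq> D - {\<one>}" "list_product G \<mu>s \<in> D" "set \<mu>s \<subseteq> carrier G"
  using assms by (auto simp: simple_tuples_def)

text \<open>The vertices of \<open>verts g \<mu>s\<close> correspond to the prefixes of the product of \<open>\<mu>s\<close>. As divisors of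
  simple elements are simple, the vertices form a chain when the whole product is simple.\<close>

lemma simple_chain_verts:
  assumes "\<mu>s \<in> simple_tuples G D k" "g \<in> carrier G"
  shows "simple_chain (verts g \<mu>s)"
proof -
  have pP: "list_product G ms \<in> P" if "set ms \<subseteq> D - {\<one>}" for ms
    using that D_P by (induction ms) (auto intro: P_mult P_one)
  have prefix: "\<exists>p\<in>P. \<exists>q\<in>P. w = h \<otimes> p \<and> list_product G ms = p \<otimes> q"
    if "w \<in> set (verts h ms)" "h \<in> carrier G" "set ms \<subseteq> D - {\<one>}" for w h ms
    using that
  proof (induction ms arbitrary: h)
    case Nil
    then show ?case using P_one by (intro bexI[of _ \<one>]) auto
  next
    case (Cons m ms)
    have m: "m \<in> P" using Cons.prems D_P by auto
    show ?case
    proof (cases "w = h")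
      case True
      then show ?thesis
        using Cons.prems(2) pP[OF Cons.prems(3)] P_one by (intro bexI[of _ \<one>] bexI[of _ "list_product G (m # ms)"]) auto
    next
      case False
      then obtain p q where "p \<in> P" "q \<in> P" "w = (h \<otimes> m) \<otimes> p" "list_product G ms = p \<otimes> q"
        using Cons.IH[of "h \<otimes> m"] Cons.prems m by auto
      then show ?thesis using m Cons.prems(2) P_mult
        by (intro bexI[of _ "m \<otimes> p"] bexI[of _ q]) (auto simp: m_assoc)
    qed
  qed
  show ?thesis
    using simple_tuplesD(2,3)[OF assms(1)] assms(2)
  proof (induction \<mu>s arbitrary: g)
    case (Cons \<mu> \<mu>s)
    have mu: "\<mu> \<in> P" "\<mu> \<noteq> \<one>" using Cons.prems D_P by auto
    have prod: "list_product G \<mu>s \<in> P" using pP Cons.prems by auto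
    then have "list_product G \<mu>s \<in> D" using D_right[OF mu(1)] Cons.prems(2) by simp
    then have ch: "simple_chain (verts (g \<otimes> \<mu>) \<mu>s)" using Cons mu by simp
    have "g \<triangleleft> w" if w: "w \<in> set (verts (g \<otimes> \<mu>) \<mu>s)" for w
    proof -
      obtain p q where pq: "p \<in> P" "q \<in> P" "w = (g \<otimes> \<mu>) \<otimes> p" "list_product G \<mu>s = p \<otimes> q"
        using prefix[of w "g \<otimes> \<mu>" \<mu>s] w Cons.prems mu by auto
      have "(\<mu> \<otimes> p) \<otimes> q \<in> D" using Cons.prems(2) pq mu by (simp add: m_assoc)
      then have "\<mu> \<otimes> p \<in> D" using D_left pq mu P_mult by blast
      moreover have "\<mu> \<otimes> p \<noteq> \<one>" using left_unit_eq_one mu pq by blast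
      moreover have "inv g \<otimes> w = \<mu> \<otimes> p"
        using pq mu Cons.prems(3) by (simp add: m_assoc)
      ultimately show ?thesis by (simp add: prec_def)
    qed
    then show ?case using ch Cons.prems(3) by (simp add: simple_chain_Cons)
  qed (simp add: simple_chain_Cons)
qed

text \<open>The product of the steps telescopes to the quotient of the last and the first vertex, and these are
  adjacent unless they coincide.\<close>

lemma steps_in_simple_tuples:
  assumes "simple_chain vs" "length vs = Suc k"
  shows "steps vs \<in> simple_tuples G D k"
proof -
  obtain v ws where vs: "vs = v # ws" using assms(2) by (cases vs) auto
  have car: "set vs \<subseteq> carrier G" using assms(1) by (simp add: simple_chain_def)
  have "list_product G (steps vs) = inv v \<otimes> last vs"
    using list_product_steps car vs by blast
  moreover have "inv v \<otimes> last vs \<in> D"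
  proof (cases "ws = []")
    case True
    then show ?thesis using vs car D_one by simp
  next
    case False
    then have "v \<triangleleft> last ws" using assms(1) vs by (simp add: simple_chain_Cons)
    then show ?thesis using vs False by (simp add: prec_def)
  qed
  moreover have "set (steps vs) \<subseteq> D - {\<one>}"
    using assms(1) by (induction vs rule: steps.induct) (auto simp: simple_chain_Cons prec_def)
  ultimately show ?thesis using assms(2) by (simp add: simple_tuples_def length_steps)
qed

lemma simple_chain_eq_verts:
  assumes "simple_chain vs" "length vs = Suc k"
  obtains g \<mu>s where "g \<in> carrier G" "\<mu>s \<in> simple_tuples G D k" "vs = verts g \<mu>s"
proof (rule that)
  have "vs \<noteq> []" using assms by auto
  then show "hd vs \<in> carrier G" using assms by (auto simp: simple_chain_def)
  show "steps vs \<in> simple_tuples G D k" by (rule steps_in_simple_tuples[OF assms])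
  show "vs = verts (hd vs) (steps vs)"
    using verts_steps \<open>vs \<noteq> []\<close> assms by (simp add: simple_chain_def)
qed

lemma simple_chain_translate_to_verts:
  assumes "simple_chain vs" "length vs = Suc k"
  obtains h \<mu>s where "h \<in> carrier G" "\<mu>s \<in> simple_tuples G D k" "vs = map (\<lambda>v. h \<otimes> v) (verts \<one> \<mu>s)"
proof -
  obtain g \<mu>s where g: "g \<in> carrier G" "\<mu>s \<in> simple_tuples G D k" "vs = verts g \<mu>s"
    using simple_chain_eq_verts[OF assms] .
  show thesis
  proof (rule that[OF g(1,2)])
    show "vs = map (\<lambda>v. g \<otimes> v) (verts \<one> \<mu>s)"
      using g map_translate_verts[of g \<one> \<mu>s] simple_tuplesD(4)[OF g(2)] by simp
  qed
qed

text \<open>The action on simplices is free: a translation that carries one of these chains to another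
  fixes its least vertex, the unit.\<close>

lemma map_translate_verts_eqD:
  assumes "h \<in> carrier G" "\<mu>s \<in> simple_tuples G D k" "\<nu>s \<in> simple_tuples G D l"
    and "map (\<lambda>v. h \<otimes> v) (verts \<one> \<mu>s) = verts \<one> \<nu>s"
  shows "h = \<one> \<and> \<mu>s = \<nu>s"
proof -
  have eq: "verts h \<mu>s = verts \<one> \<nu>s"
    using assms map_translate_verts[of h \<one> \<mu>s] simple_tuplesD(4)[OF assms(2)] by simp
  then have "h = \<one>" using hd_verts by metis
  moreover have "\<mu>s = \<nu>s"
    using eq steps_verts assms simple_tuplesD(4) by (metis one_closed)
  ultimately show ?thesis ..
qed

lemma finite_simple_tuples: "finite (simple_tuples G D k)"
proof (rule finite_subset)
  show "simple_tuples G D k \<subseteq> {\<mu>s. set \<mu>s \<subseteq> D \<and> length \<mu>s = k}"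
    by (auto simp: simple_tuples_def)
  show "finite {\<mu>s. set \<mu>s \<subseteq> D \<and> length \<mu>s = k}"
    by (rule finite_lists_length_eq[OF D_finite])
qed

lemma simple_tuples_0: "simple_tuples G D 0 = {[]}"
  using D_one by (auto simp: simple_tuples_def)

end


section \<open>The ordered chain complex on vertex lists\<close>

text \<open>Lists of length \<open>k + 1\<close> stand for ordered \<open>k\<close>-simplices. The empty list spans degree \<open>-1\<close>, so
  that the boundary of a vertex is its augmentation.\<close>

definition chain_cons :: "'v \<Rightarrow> ('v list \<Rightarrow>\<^sub>0 int) \<Rightarrow> ('v list \<Rightarrow>\<^sub>0 int)"
  where "chain_cons v = frag_extend (\<lambda>vs. frag_of (v # vs))"

primrec list_boundary :: "'v list \<Rightarrow> ('v list \<Rightarrow>\<^sub>0 int)"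
  where "list_boundary [] = 0"
  | "list_boundary (v # vs) = frag_of vs - chain_cons v (list_boundary vs)"

definition boundary :: "('v list \<Rightarrow>\<^sub>0 int) \<Rightarrow> ('v list \<Rightarrow>\<^sub>0 int)"
  where "boundary = frag_extend list_boundary"

text \<open>Joining with a vertex at the end. The sign makes this a contraction, see
  \<open>boundary_snoc\<close>.\<close>

definition chain_snoc :: "'v \<Rightarrow> ('v list \<Rightarrow>\<^sub>0 int) \<Rightarrow> ('v list \<Rightarrow>\<^sub>0 int)"
  where "chain_snoc f = frag_extend (\<lambda>vs. frag_cmul ((-1) ^ length vs) (frag_of (vs @ [f])))"

lemma chain_linear:
  "chain_cons v 0 = 0" "chain_cons v (x - y) = chain_cons v x - chain_cons v y"
  "chain_cons v (- x) = - chain_cons v x"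
  "boundary 0 = 0" "boundary (x - y) = boundary x - boundary y" "boundary (- x) = - boundary x"
  "boundary (x + y) = boundary x + boundary y"
  "chain_snoc f 0 = 0" "chain_snoc f (x - y) = chain_snoc f x - chain_snoc f y"
  "chain_snoc f (- x) = - chain_snoc f x"
  by (simp_all add: chain_cons_def boundary_def chain_snoc_def frag_extend_diff frag_extend_minus
      frag_extend_add)

lemma boundary_of [simp]: "boundary (frag_of vs) = list_boundary vs"
  by (simp add: boundary_def)

lemma chain_cons_of [simp]: "chain_cons v (frag_of vs) = frag_of (v # vs)"
  by (simp add: chain_cons_def)

lemma boundary_cons: "boundary (chain_cons v x) = x - chain_cons v (boundary x)"
  using subset_UNIV[of "Poly_Mapping.keys x"]
  by (induction x rule: frag_induction) (simp_all add: chain_linear)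

lemma boundary_boundary: "boundary (boundary x) = 0"
  using subset_UNIV[of "Poly_Mapping.keys x"]
proof (induction x rule: frag_induction)
  case (one vs)
  show ?case by (induction vs) (simp_all add: chain_linear boundary_cons)
qed (simp_all add: chain_linear)

lemma chain_snoc_cons: "chain_snoc f (chain_cons v x) = - chain_cons v (chain_snoc f x)"
  using subset_UNIV[of "Poly_Mapping.keys x"]
proof (induction x rule: frag_induction)
  case (one vs)
  show ?case
    by (simp add: chain_snoc_def chain_cons_def frag_extend_cmul flip: minus_frag_cmul)
qed (simp_all add: chain_linear)

lemma boundary_snoc: "boundary (chain_snoc f x) = x - chain_snoc f (boundary x)"
  using subset_UNIV[of "Poly_Mapping.keys x"]
proof (induction x rule: frag_induction)
  case (one vs)
  show ?case
  proof (induction vs)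
    case Nil
    show ?case by (simp add: chain_linear) (simp add: chain_snoc_def chain_linear)
  next
    case (Cons v vs)
    have "boundary (chain_snoc f (frag_of (v # vs)))
        = - boundary (chain_cons v (chain_snoc f (frag_of vs)))"
      by (metis chain_cons_of chain_snoc_cons chain_linear(6))
    also have "\<dots> = chain_cons v (frag_of vs - chain_snoc f (list_boundary vs)) - chain_snoc f (frag_of vs)"
      using Cons by (simp add: boundary_cons)
    also have "\<dots> = frag_of (v # vs) - chain_snoc f (boundary (frag_of (v # vs)))"
      by (simp add: chain_linear chain_snoc_cons)
    finally show ?case .
  qed
qed (simp_all add: chain_linear)

lemma keys_list_boundary:
  assumes "us \<in> Poly_Mapping.keys (list_boundary vs)"
  obtains as v bs where "vs = as @ v # bs" "us = as @ bs"
proof -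
  have "\<exists>as v bs. vs = as @ v # bs \<and> us = as @ bs"
    using assms
  proof (induction vs arbitrary: us)
    case (Cons v vs)
    then have "us \<in> Poly_Mapping.keys (frag_of vs) \<union> Poly_Mapping.keys (chain_cons v (list_boundary vs))"
      using keys_diff by fastforce
    then consider "us = vs" | ws where "ws \<in> Poly_Mapping.keys (list_boundary vs)" "us = v # ws"
      using keys_frag_extend[of "\<lambda>vs. frag_of (v # vs)" "list_boundary vs"]
      by (auto simp: chain_cons_def)
    then show ?case
    proof cases
      case 1
      then show ?thesis by (intro exI[of _ "[]"]) auto
    next
      case 2
      then obtain as w bs where "vs = as @ w # bs" "ws = as @ bs" using Cons.IH by blast
      then show ?thesis using 2 by (intro exI[of _ "v # as"]) auto
    qed
  qed simp
  then show thesis using that by blast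
qed

lemma boundary_in:
  assumes "Poly_Mapping.keys x \<subseteq> S"
    and "\<And>as v bs. as @ v # bs \<in> S \<Longrightarrow> as @ bs \<in> T"
  shows "Poly_Mapping.keys (boundary x) \<subseteq> T"
proof
  fix us assume "us \<in> Poly_Mapping.keys (boundary x)"
  then obtain vs where "vs \<in> S" "us \<in> Poly_Mapping.keys (list_boundary vs)"
    using assms(1) keys_frag_extend[of list_boundary x] by (fastforce simp: boundary_def)
  then show "us \<in> T" using assms(2) keys_list_boundary by metis
qed

lemma chain_cons_in:
  "Poly_Mapping.keys (chain_cons v x) \<subseteq> (\<lambda>vs. v # vs) ` Poly_Mapping.keys x"
  using keys_frag_extend[of "\<lambda>vs. frag_of (v # vs)" x] by (auto simp: chain_cons_def)

lemma chain_snoc_in: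
  "Poly_Mapping.keys (chain_snoc f x) \<subseteq> (\<lambda>vs. vs @ [f]) ` Poly_Mapping.keys x"
  using keys_frag_extend[of "\<lambda>vs. frag_cmul ((-1) ^ length vs) (frag_of (vs @ [f]))" x]
  by (auto simp: chain_snoc_def split: if_splits)


section \<open>Acyclicity\<close>

context garside_order
begin

text \<open>Above \<open>v\<close> and below \<open>g\<close> there is a greatest neighbour of \<open>v\<close>, namely \<open>v \<otimes> s\<close> where \<open>s\<close> is the
  greatest simple left divisor of \<open>inv v \<otimes> g\<close>. Hence the ascending link of
  \<open>v\<close> among the vertices below \<open>g\<close> is a cone.\<close>

definition greatest_neighbour :: "'a \<Rightarrow> 'a \<Rightarrow> 'a \<Rightarrow> bool"
  where "greatest_neighbour g v f \<longleftrightarrow> f \<in> carrier G \<and> v \<triangleleft> f \<and> inv f \<otimes> g \<in> P \<and>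
    (\<forall>w\<in>carrier G. v \<triangleleft> w \<and> inv w \<otimes> g \<in> P \<longrightarrow> w = f \<or> w \<triangleleft> f)"

lemma greatest_neighbour_exists:
  assumes g: "g \<in> carrier G" and v: "v \<in> carrier G" "inv v \<otimes> g \<in> P" "v \<noteq> g"
  shows "\<exists>f. greatest_neighbour g v f"
proof -
  define p where "p = inv v \<otimes> g"
  have "p \<noteq> \<one>" using v g inv_equality[of "inv v" g] by (auto simp: p_def)
  moreover have "p \<in> P" using v(2) by (simp add: p_def)
  ultimately obtain s where s: "s \<in> D" "s \<noteq> \<one>" "\<exists>q\<in>P. p = s \<otimes> q"
    and max: "\<And>t. \<lbrakk>t \<in> D; \<exists>q\<in>P. p = t \<otimes> q\<rbrakk> \<Longrightarrow> \<exists>r\<in>P. s = t \<otimes> r"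
    using greatest_simple by blast
  obtain q where q: "q \<in> P" "p = s \<otimes> q" using s(3) by blast
  have "g = v \<otimes> (s \<otimes> q)" using q(2) v g unfolding p_def by (metis inv_mult_cancel(2))
  then have fg: "inv (v \<otimes> s) \<otimes> g = q" using s q v by (simp add: m_assoc inv_mult_group)
  have "w = v \<otimes> s \<or> w \<triangleleft> v \<otimes> s" if w: "w \<in> carrier G" "v \<triangleleft> w" "inv w \<otimes> g \<in> P" for w
  proof -
    define t where "t = inv v \<otimes> w"
    have t: "t \<in> D" using w by (simp add: t_def prec_def)
    have "p = t \<otimes> (inv w \<otimes> g)" using inv_mult_telescope[of v w g] v w g by (simp add: p_def t_def)
    then obtain r where r: "r \<in> P" "s = t \<otimes> r" using max t w(3) by blast
    then have rD: "r \<in> D" using D_right[of t r] t s D_P by blast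
    have vt: "v \<otimes> t = w" using v w by (simp add: t_def)
    then have "v \<otimes> s = w \<otimes> r" using r v t by (simp add: m_assoc[symmetric])
    then have "inv w \<otimes> (v \<otimes> s) = r" using w r by simp
    then show ?thesis using rD \<open>v \<otimes> s = w \<otimes> r\<close> w(1) by (cases "r = \<one>") (auto simp: prec_def)
  qed
  then have "greatest_neighbour g v (v \<otimes> s)"
    using s v fg q by (auto simp: greatest_neighbour_def prec_def)
  then show ?thesis ..
qed

definition top_neighbour :: "'a \<Rightarrow> 'a \<Rightarrow> 'a"
  where "top_neighbour g v = (SOME f. greatest_neighbour g v f)"

lemma top_neighbour:
  assumes "g \<in> carrier G" "v \<in> carrier G" "inv v \<otimes> g \<in> P" "v \<noteq> g"
  shows "greatest_neighbour g v (top_neighbour g v)"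
  unfolding top_neighbour_def by (rule someI_ex) (rule greatest_neighbour_exists[OF assms])

definition chain_below :: "'a \<Rightarrow> 'a list \<Rightarrow> bool"
  where "chain_below g vs \<longleftrightarrow> simple_chain vs \<and> (\<forall>v\<in>set vs. inv v \<otimes> g \<in> P)"

lemma chain_below_Cons:
  "chain_below g (v # vs) \<longleftrightarrow> v \<in> carrier G \<and> inv v \<otimes> g \<in> P \<and> (\<forall>w\<in>set vs. v \<triangleleft> w) \<and> chain_below g vs"
  by (auto simp: chain_below_def simple_chain_Cons)

lemma chain_below_snoc:
  "chain_below g (vs @ [f]) \<longleftrightarrow> f \<in> carrier G \<and> inv f \<otimes> g \<in> P \<and> (\<forall>w\<in>set vs. w \<triangleleft> f) \<and> chain_below g vs"
  by (auto simp: chain_below_def simple_chain_def sorted_wrt_append)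

lemma chain_below_top:
  assumes g: "g \<in> carrier G" and ws: "chain_below g (g # ws)"
  shows "ws = []"
proof (rule ccontr)
  assume "ws \<noteq> []"
  then obtain w where "w \<in> set ws" by (cases ws) auto
  then have w: "w \<in> carrier G" "g \<triangleleft> w" "inv w \<otimes> g \<in> P"
    using ws by (auto simp: chain_below_def simple_chain_Cons simple_chain_def)
  have "inv w \<otimes> g = \<one>" using strict_P_asym[OF g w(1) prec_strict_P[OF w(2)]] w(3) by blast
  then have "w = g" using inv_mult_cancel(2)[OF w(1) g] w(1) by simp
  then show False using w(2) prec_irrefl[OF g] by simp
qed

text \<open>The value on a chain starting at \<open>v\<close> is the cone construction in the link of \<open>v\<close>, carried out
  on ordered chains: append the apex, or give \<open>0\<close> if the apex is already there. The outer sign is the one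
  in \<open>boundary_cons\<close>.\<close>

fun list_contraction :: "'a \<Rightarrow> 'a list \<Rightarrow> ('a list \<Rightarrow>\<^sub>0 int)"
  where "list_contraction g [] = 0"
  | "list_contraction g (v # vs) = (if v = g \<or> top_neighbour g v \<in> set vs then 0
      else - chain_cons v (chain_snoc (top_neighbour g v) (frag_of vs)))"

definition contraction :: "'a \<Rightarrow> ('a list \<Rightarrow>\<^sub>0 int) \<Rightarrow> ('a list \<Rightarrow>\<^sub>0 int)"
  where "contraction g = frag_extend (list_contraction g)"

lemma contraction_linear:
  "contraction g 0 = 0" "contraction g (x - y) = contraction g x - contraction g y"
  "contraction g (- x) = - contraction g x" "contraction g (frag_of vs) = list_contraction g vs"
  by (simp_all add: contraction_def frag_extend_diff frag_extend_minus)

lemma contraction_cons: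
  assumes "v \<noteq> g" "\<And>vs. vs \<in> Poly_Mapping.keys x \<Longrightarrow> top_neighbour g v \<notin> set vs"
  shows "contraction g (chain_cons v x) = - chain_cons v (chain_snoc (top_neighbour g v) x)"
proof -
  have "Poly_Mapping.keys x \<subseteq> {vs. top_neighbour g v \<notin> set vs}" using assms(2) by blast
  then show ?thesis
    by (induction x rule: frag_induction) (use assms(1) in \<open>auto simp: chain_linear contraction_linear\<close>)
qed

lemma contraction_cons_snoc:
  assumes "v \<noteq> g"
  shows "contraction g (chain_cons v (chain_snoc (top_neighbour g v) x)) = 0"
  using subset_UNIV[of "Poly_Mapping.keys x"]
proof (induction x rule: frag_induction)
  case (one vs)
  show ?case
    using assms
    by (simp add: chain_snoc_def chain_cons_def frag_extend_cmul contraction_def)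
qed (simp_all add: chain_linear contraction_linear)

text \<open>The apex lies above the rest of a chain that does not contain it, so appending it gives a
  chain again.\<close>

lemma keys_list_contraction:
  assumes g: "g \<in> carrier G" and vs: "chain_below g vs"
    and us: "us \<in> Poly_Mapping.keys (list_contraction g vs)"
  shows "chain_below g us \<and> length us = Suc (length vs)"
proof -
  obtain v ws where v: "vs = v # ws" using us by (cases vs) auto
  let ?f = "top_neighbour g v"
  have ne: "v \<noteq> g" "?f \<notin> set ws" using us v by (auto split: if_splits)
  have f: "greatest_neighbour g v ?f" using top_neighbour[OF g] vs v ne by (auto simp: chain_below_Cons)
  have "us = v # ws @ [?f]"
    using us v ne chain_cons_in[of v "chain_snoc ?f (frag_of ws)"] chain_snoc_in[of ?f "frag_of ws"]
    by auto
  moreover have "w \<triangleleft> ?f" if "w \<in> set ws" for w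
    using that f vs ne unfolding v chain_below_def greatest_neighbour_def
    by (auto simp: simple_chain_Cons simple_chain_def)
  ultimately show ?thesis
    using vs v f unfolding greatest_neighbour_def
    by (auto simp: chain_below_Cons chain_below_snoc)
qed

lemma len_decreases:
  assumes "g \<in> carrier G" "v \<in> carrier G" "w \<in> carrier G" "v \<triangleleft> w" "inv w \<otimes> g \<in> P"
  shows "len (inv w \<otimes> g) < len (inv v \<otimes> g)"
  using len_less[of "inv v \<otimes> w" "inv w \<otimes> g"] assms prec_strict_P[of v w] inv_mult_telescope[of v w g]
  by auto

text \<open>Up to chains starting at a vertex closer to \<open>g\<close>, the contraction is a chain homotopy from the
  identity to zero: on the chains starting at \<open>v\<close> it is induced by the cone structure of the ascending
  link of \<open>v\<close>.\<close>

lemma contraction_defect: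
  assumes g: "g \<in> carrier G" and vs: "chain_below g (v # vs)" and ne: "v \<noteq> g"
    and us: "us \<in> Poly_Mapping.keys (frag_of (v # vs)
      - boundary (list_contraction g (v # vs)) - contraction g (list_boundary (v # vs)))"
  shows "chain_below g us \<and> length us = Suc (length vs) \<and> len (inv (hd us) \<otimes> g) < len (inv v \<otimes> g)"
proof -
  let ?f = "top_neighbour g v"
  have v: "v \<in> carrier G" "inv v \<otimes> g \<in> P" "\<And>w. w \<in> set vs \<Longrightarrow> v \<triangleleft> w" "chain_below g vs"
    using vs by (auto simp: chain_below_Cons)
  have f: "?f \<in> carrier G" "v \<triangleleft> ?f" "inv ?f \<otimes> g \<in> P"
    and max: "\<And>w. \<lbrakk>w \<in> carrier G; v \<triangleleft> w; inv w \<otimes> g \<in> P\<rbrakk> \<Longrightarrow> w = ?f \<or> w \<triangleleft> ?f"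
    using top_neighbour[OF g v(1,2) ne] by (auto simp: greatest_neighbour_def)
  have vsf: "w = ?f \<or> w \<triangleleft> ?f" "w \<in> carrier G" "inv w \<otimes> g \<in> P" if "w \<in> set vs" for w
    using max[of w] v(3)[OF that] v(4) that by (auto simp: chain_below_def simple_chain_def)
  have good: "chain_below g ws \<and> length ws = Suc (length vs) \<and> len (inv (hd ws) \<otimes> g) < len (inv v \<otimes> g)"
    if key: "ws \<in> Poly_Mapping.keys (list_contraction g vs)" for ws
  proof -
    have ws: "chain_below g ws" "length ws = Suc (length vs)"
      using keys_list_contraction[OF g v(4) key] by auto
    obtain u us' where u: "vs = u # us'" using key by (cases vs) auto
    then have "hd ws = u"
      using key chain_cons_in[of u "chain_snoc (top_neighbour g u) (frag_of us')"]
      by (auto split: if_splits)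
    then show ?thesis using ws len_decreases[OF g v(1)] v(3)[of u] vsf[of u] u by auto
  qed
  show ?thesis
  proof (cases "?f \<in> set vs")
    case True
    \<comment> \<open>Being the greatest neighbour, \<open>?f\<close> is the last entry, and \<open>v # vs\<close> is hit by the contraction.\<close>
    obtain as bs where split: "vs = as @ ?f # bs" using split_list[OF True] by blast
    have "bs = []"
    proof (rule ccontr)
      assume "bs \<noteq> []"
      then obtain b where b: "b \<in> set bs" by (cases bs) auto
      then have "?f \<triangleleft> b" using v(4) split by (auto simp: chain_below_def simple_chain_def sorted_wrt_append)
      moreover have "b \<in> set vs" using b split by simp
      ultimately show False using vsf(1,2)[of b] prec_asym[OF f(1)] prec_irrefl[OF f(1)] by metis
    qed
    then have split: "vs = as @ [?f]" using split by simp
    have fas: "?f \<notin> set as"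
      using simple_chain_distinct[of vs] v(4) split by (auto simp: chain_below_def)
    let ?e = "(-1) ^ length as :: int"
    have e: "?e * ?e = 1" by (simp flip: power_add)
    have frag: "frag_of vs = frag_cmul ?e (chain_snoc ?f (frag_of as))"
      using split e by (simp add: chain_snoc_def)
    have cb: "boundary (frag_cmul c x) = frag_cmul c (boundary x)"
      "chain_cons u (frag_cmul c x) = frag_cmul c (chain_cons u x)"
      "contraction g (frag_cmul c x) = frag_cmul c (contraction g x)" for c u and x :: "'a list \<Rightarrow>\<^sub>0 int"
      by (simp_all add: boundary_def chain_cons_def contraction_def frag_extend_cmul)
    have neg: "frag_cmul c (- x) = - frag_cmul c x" for c and x :: "'a list \<Rightarrow>\<^sub>0 int"
      by (rule poly_mapping_eqI) simp
    have bvs: "list_boundary vs = frag_cmul ?e (frag_of as - chain_snoc ?f (list_boundary as))"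
      using arg_cong[OF frag, of boundary] by (simp add: boundary_snoc cb)
    have "contraction g (chain_cons v (list_boundary vs))
        = frag_cmul ?e (contraction g (chain_cons v (frag_of as)))"
      unfolding bvs cb by (simp add: chain_linear(2) contraction_linear(2) contraction_cons_snoc[OF ne])
    also have "\<dots> = - frag_cmul ?e (chain_cons v (chain_snoc ?f (frag_of as)))"
      using contraction_cons[OF ne, of "frag_of as"] fas by (simp add: neg)
    also have "\<dots> = - frag_of (v # vs)"
      using frag by (metis cb(2) chain_cons_of)
    finally have "frag_of (v # vs) - boundary (list_contraction g (v # vs))
        - contraction g (list_boundary (v # vs)) = - list_contraction g vs"
      using True by (simp add: contraction_linear chain_linear)
    then show ?thesis using us good by simp
  next
    case False
    have below: "w \<triangleleft> ?f" if "w \<in> set vs" for w using vsf[OF that] that False by blast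
    have "?f \<notin> set ws" if "ws \<in> Poly_Mapping.keys (list_boundary vs)" for ws
      using keys_list_boundary[OF that] False by (metis Un_iff list.set_intros(2) set_append)
    then have "contraction g (chain_cons v (list_boundary vs))
        = - chain_cons v (chain_snoc ?f (list_boundary vs))"
      by (rule contraction_cons[OF ne])
    moreover have "boundary (list_contraction g (v # vs))
        = chain_cons v (frag_of vs - chain_snoc ?f (list_boundary vs)) - chain_snoc ?f (frag_of vs)"
      using False ne by (simp add: chain_linear(6) boundary_cons boundary_snoc)
    ultimately have "frag_of (v # vs) - boundary (list_contraction g (v # vs))
        - contraction g (list_boundary (v # vs)) = chain_snoc ?f (frag_of vs) - list_contraction g vs"
      by (simp add: contraction_linear chain_linear(2))
    then have "us \<in> Poly_Mapping.keys (chain_snoc ?f (frag_of vs)) \<union> Poly_Mapping.keys (list_contraction g vs)"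
      using us keys_diff by fastforce
    then consider "us = vs @ [?f]" | "us \<in> Poly_Mapping.keys (list_contraction g vs)"
      using chain_snoc_in[of ?f "frag_of vs"] by auto
    then show ?thesis
    proof cases
      case 1
      then have "chain_below g us" using v(4) below f by (simp add: chain_below_snoc)
      moreover have "v \<triangleleft> hd us" "hd us \<in> carrier G" "inv (hd us) \<otimes> g \<in> P"
        using 1 v(3) f vsf by (cases vs; auto)+
      ultimately show ?thesis using 1 len_decreases[OF g v(1)] by auto
    next
      case 2
      then show ?thesis by (rule good)
    qed
  qed
qed

text \<open>The vertex \<open>g\<close> is admitted in every stage, whatever the value of \<open>len\<close> at the unit.\<close>

definition filtration :: "'a \<Rightarrow> nat \<Rightarrow> nat \<Rightarrow> 'a list set"
  where "filtration g n k = {vs. chain_below g vs \<and> length vs = Suc k \<and>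
    (hd vs = g \<or> len (inv (hd vs) \<otimes> g) < n)}"

text \<open>Subtracting the boundary of the contraction moves a cycle one step down the filtration. At the
  bottom only the vertex \<open>g\<close> is left, which supports no nonzero cycle since degree \<open>-1\<close> is included.\<close>

lemma cycle_is_boundary_filtration:
  assumes g: "g \<in> carrier G" and z: "Poly_Mapping.keys z \<subseteq> filtration g n k" and cyc: "boundary z = 0"
  shows "\<exists>w. Poly_Mapping.keys w \<subseteq> {vs. simple_chain vs \<and> length vs = Suc (Suc k)} \<and> boundary w = z"
  using z cyc
proof (induction n arbitrary: z)
  case 0
  have single: "vs = [g]" if mem: "vs \<in> filtration g 0 k" for vs
  proof -
    obtain ws where vs: "vs = g # ws" using mem by (cases vs) (auto simp: filtration_def)
    have "ws = []" using chain_below_top[OF g] mem vs by (simp add: filtration_def)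
    then show ?thesis using vs by simp
  qed
  have "z = 0"
  proof (rule ccontr)
    assume "z \<noteq> 0"
    then have keys: "Poly_Mapping.keys z = {[g]}" using single 0 by (metis keys_eq_empty subset_singletonD subsetI singletonI subset_trans)
    then have "boundary z = frag_cmul (Poly_Mapping.lookup z [g]) (frag_of [])"
      by (simp add: boundary_def frag_extend_def chain_linear)
    moreover have "Poly_Mapping.lookup z [g] \<noteq> 0" using keys by (metis in_keys_iff singletonI)
    ultimately show False using 0 by simp
  qed
  then show ?case by (intro exI[of _ 0]) (simp add: chain_linear)
next
  case (Suc n)
  let ?h = "\<lambda>vs. frag_of vs - boundary (list_contraction g vs) - contraction g (list_boundary vs)"
  let ?z = "z - boundary (contraction g z)"
  have lin: "frag_extend ?h x = x - boundary (contraction g x) - contraction g (boundary x)" for x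
    using subset_UNIV[of "Poly_Mapping.keys x"]
    by (induction x rule: frag_induction) (simp_all add: chain_linear contraction_linear frag_extend_diff)
  have h: "Poly_Mapping.keys (?h vs) \<subseteq> filtration g n k" if vs: "vs \<in> filtration g (Suc n) k" for vs
  proof (cases "hd vs = g")
    case True
    obtain ws where w: "vs = g # ws" using True vs by (cases vs) (auto simp: filtration_def)
    have "ws = []" using chain_below_top[OF g] vs w by (simp add: filtration_def)
    then show ?thesis using w vs by (auto simp: chain_linear contraction_linear filtration_def)
  next
    case False
    then obtain v ws where w: "vs = v # ws" "v \<noteq> g" using vs by (cases vs) (auto simp: filtration_def)
    show ?thesis
    proof
      fix us assume "us \<in> Poly_Mapping.keys (?h vs)"
      then show "us \<in> filtration g n k"
        using contraction_defect[OF g, of v ws us] vs w by (auto simp: filtration_def)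
    qed
  qed
  have "?z = frag_extend ?h z" using lin[of z] Suc.prems(2) by (simp add: contraction_linear)
  then have "Poly_Mapping.keys ?z \<subseteq> filtration g n k"
    using keys_frag_extend[of ?h z] h Suc.prems(1) by fastforce
  then obtain w where w: "Poly_Mapping.keys w \<subseteq> {vs. simple_chain vs \<and> length vs = Suc (Suc k)}" "boundary w = ?z"
    using Suc.IH[of ?z] Suc.prems(2) by (auto simp: chain_linear boundary_boundary)
  have "Poly_Mapping.keys (contraction g z) \<subseteq> {vs. simple_chain vs \<and> length vs = Suc (Suc k)}"
  proof
    fix us assume "us \<in> Poly_Mapping.keys (contraction g z)"
    then obtain vs where "vs \<in> filtration g (Suc n) k" "us \<in> Poly_Mapping.keys (list_contraction g vs)"
      using keys_frag_extend[of "list_contraction g" z] Suc.prems(1) by (auto simp: contraction_def)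
    then show "us \<in> {vs. simple_chain vs \<and> length vs = Suc (Suc k)}"
      using keys_list_contraction[OF g, of vs us] by (auto simp: filtration_def chain_below_def)
  qed
  then have "Poly_Mapping.keys (w + contraction g z) \<subseteq> {vs. simple_chain vs \<and> length vs = Suc (Suc k)}"
    using w(1) keys_add[of w "contraction g z"] by blast
  moreover have "boundary (w + contraction g z) = z" using w(2) by (simp add: chain_linear)
  ultimately show ?case by blast
qed

text \<open>This is the acyclicity of the complex: in degree \<open>0\<close>, the hypothesis on the boundary says that the
  augmentation vanishes.\<close>

theorem cycle_is_boundary:
  assumes z: "Poly_Mapping.keys z \<subseteq> {vs. simple_chain vs \<and> length vs = Suc k}" and cyc: "boundary z = 0"
  shows "\<exists>w. Poly_Mapping.keys w \<subseteq> {vs. simple_chain vs \<and> length vs = Suc (Suc k)} \<and> boundary w = z"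
proof -
  let ?X = "\<Union>(set ` Poly_Mapping.keys z)"
  have "finite ?X" "?X \<subseteq> carrier G" using z by (auto simp: simple_chain_def)
  from bounded[OF this] obtain g where g: "g \<in> carrier G" "\<forall>v\<in>?X. inv v \<otimes> g \<in> P" ..
  obtain n where n: "\<And>vs. vs \<in> Poly_Mapping.keys z \<Longrightarrow> len (inv (hd vs) \<otimes> g) < n"
    using finite_nat_set_iff_bounded[of "(\<lambda>vs. len (inv (hd vs) \<otimes> g)) ` Poly_Mapping.keys z"] by auto
  have "Poly_Mapping.keys z \<subseteq> filtration g n k"
    using z g(2) n by (auto simp: filtration_def chain_below_def)
  then show ?thesis using cycle_is_boundary_filtration g(1) cyc by blast
qed

end


section \<open>Affine simplices in the realization\<close>

definition simplex_point :: "'v list \<Rightarrow> (nat \<Rightarrow> real) \<Rightarrow> 'v \<Rightarrow> real"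
  where "simplex_point vs x = (\<lambda>v. \<Sum>i | i < length vs \<and> vs ! i = v. x i)"

definition barycentric_coords :: "'v list \<Rightarrow> ('v \<Rightarrow> real) \<Rightarrow> nat \<Rightarrow> real"
  where "barycentric_coords vs \<alpha> = (\<lambda>i. if i < length vs then \<alpha> (vs ! i) else 0)"

lemma simplex_point_nth:
  assumes "distinct vs" "i < length vs"
  shows "simplex_point vs x (vs ! i) = x i"
proof -
  have "{j. j < length vs \<and> vs ! j = vs ! i} = {i}"
    using assms by (auto simp: nth_eq_iff_index_eq)
  then show ?thesis by (simp add: simplex_point_def)
qed

lemma simplex_point_outside: "v \<notin> set vs \<Longrightarrow> simplex_point vs x v = 0"
  unfolding simplex_point_def by (rule sum.neutral) auto

lemma support_simplex_point:
  "distinct vs \<Longrightarrow> {v. simplex_point vs x v \<noteq> 0} = {vs ! i | i. i < length vs \<and> x i \<noteq> 0}"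
  by (auto simp: simplex_point_nth)
    (metis in_set_conv_nth simplex_point_nth simplex_point_outside)

lemma barycentric_coords_simplex_point:
  assumes "distinct vs" "length vs = Suc k" "x \<in> standard_simplex k"
  shows "barycentric_coords vs (simplex_point vs x) = x"
  using assms by (auto simp: barycentric_coords_def simplex_point_nth standard_simplex_def)

lemma sum_simplex_point:
  assumes "distinct vs" "length vs = Suc k" "finite S" "set vs \<subseteq> S"
  shows "(\<Sum>v\<in>S. simplex_point vs x v) = (\<Sum>i\<le>k. x i)"
proof -
  have "(\<Sum>v\<in>S. simplex_point vs x v) = (\<Sum>v\<in>set vs. simplex_point vs x v)"
    using assms by (intro sum.mono_neutral_right) (auto simp: simplex_point_outside)
  also have "\<dots> = (\<Sum>i<length vs. simplex_point vs x (vs ! i))"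
    using assms(1) by (intro sum.reindex_bij_betw[symmetric] bij_betw_nth) auto
  also have "\<dots> = (\<Sum>i<length vs. x i)"
    using assms(1) by (intro sum.cong) (auto simp: simplex_point_nth)
  finally show ?thesis using assms(2) by (simp add: lessThan_Suc_atMost)
qed

lemma simplex_point_in_closed_simplex:
  assumes vs: "distinct vs" "length vs = Suc k" and x: "x \<in> standard_simplex k"
    and K: "\<And>\<tau>. \<lbrakk>\<tau> \<subseteq> set vs; \<tau> \<noteq> {}\<rbrakk> \<Longrightarrow> \<tau> \<in> K"
  shows "simplex_point vs x \<in> closed_simplex K (set vs)"
proof -
  let ?S = "{v. simplex_point vs x v \<noteq> 0}"
  have sub: "?S \<subseteq> set vs" using simplex_point_outside by force
  have x1: "(\<Sum>i\<le>k. x i) = 1" "\<And>i. 0 \<le> x i" using x by (auto simp: standard_simplex_def)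
  have "(\<Sum>v\<in>?S. simplex_point vs x v) = (\<Sum>v\<in>set vs. simplex_point vs x v)"
    using sub by (intro sum.mono_neutral_left) auto
  then have s1: "(\<Sum>v\<in>?S. simplex_point vs x v) = 1"
    using sum_simplex_point[OF vs] x1 by simp
  then have "?S \<noteq> {}" by (metis sum.empty zero_neq_one)
  then have "?S \<in> K" using K sub by blast
  moreover have "0 \<le> simplex_point vs x v" for v
    unfolding simplex_point_def by (intro sum_nonneg) (simp add: x1)
  ultimately show ?thesis using s1 sub by (simp add: closed_simplex_def realization_def)
qed

lemma simplex_point_barycentric_coords:
  assumes vs: "distinct vs" and "{v. \<alpha> v \<noteq> 0} \<subseteq> set vs"
  shows "simplex_point vs (barycentric_coords vs \<alpha>) = \<alpha>"
proof
  fix v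
  show "simplex_point vs (barycentric_coords vs \<alpha>) v = \<alpha> v"
  proof (cases "v \<in> set vs")
    case True
    then show ?thesis using vs by (auto simp: in_set_conv_nth simplex_point_nth barycentric_coords_def)
  next
    case False
    then show ?thesis using assms by (auto simp: simplex_point_outside)
  qed
qed

lemma barycentric_coords_in_standard_simplex:
  assumes vs: "distinct vs" "length vs = Suc k" and \<alpha>: "\<alpha> \<in> closed_simplex K (set vs)"
  shows "barycentric_coords vs \<alpha> \<in> standard_simplex k"
proof -
  let ?x = "barycentric_coords vs \<alpha>"
  have a: "{v. \<alpha> v \<noteq> 0} \<subseteq> set vs" "\<And>v. 0 \<le> \<alpha> v" "(\<Sum>v | \<alpha> v \<noteq> 0. \<alpha> v) = 1"
    using \<alpha> by (auto simp: closed_simplex_def realization_def)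
  have nn: "0 \<le> ?x i" for i using a by (simp add: barycentric_coords_def)
  have "(\<Sum>v | \<alpha> v \<noteq> 0. \<alpha> v) = (\<Sum>v\<in>set vs. \<alpha> v)"
    using a(1) by (intro sum.mono_neutral_left) auto
  then have s: "(\<Sum>i\<le>k. ?x i) = 1"
    using sum_simplex_point[OF vs, of "set vs" ?x] a(3) simplex_point_barycentric_coords[OF vs(1) a(1)]
    by simp
  have "?x i \<le> 1" for i
  proof (cases "i \<le> k")
    case True
    then show ?thesis using member_le_sum[of i "{..k}" ?x] nn s by simp
  next
    case False
    then show ?thesis using vs by (simp add: barycentric_coords_def)
  qed
  then show ?thesis using nn s vs by (auto simp: standard_simplex_def barycentric_coords_def)
qed

lemma continuous_on_simplex_point: "continuous_on S (simplex_point vs)"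
  unfolding simplex_point_def
  by (intro continuous_on_coordinatewise_then_product continuous_on_sum)
    (rule continuous_on_subset[OF continuous_on_product_coordinates subset_UNIV])

lemma continuous_on_barycentric_coords: "continuous_on S (barycentric_coords vs)"
  unfolding barycentric_coords_def
proof (intro continuous_on_coordinatewise_then_product)
  fix i
  show "continuous_on S (\<lambda>\<alpha>. if i < length vs then \<alpha> (vs ! i) else 0)"
    by (cases "i < length vs")
      (simp_all add: continuous_on_subset[OF continuous_on_product_coordinates subset_UNIV])
qed

lemma openin_top_of_set_preimage:
  assumes "continuous_map (top_of_set S) (top_of_set T) f" "openin (top_of_set T) V"
  shows "openin (top_of_set S) {x \<in> S. f x \<in> V}"
  using openin_continuous_map_preimage[OF assms] by simp

lemma standard_simplex_topology:
  "subtopology (powertop_real UNIV) (standard_simplex k) = top_of_set (standard_simplex k)"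
  by (simp add: euclidean_product_topology)

lemma topspace_realization_topology [simp]: "topspace (realization_topology K) = realization K"
proof
  show "topspace (realization_topology K) \<subseteq> realization K"
    using openin_realization_topology openin_topspace by blast
  have "realization K \<inter> closed_simplex K \<sigma> = closed_simplex K \<sigma>" for \<sigma>
    by (auto simp: closed_simplex_def)
  then have "openin (realization_topology K) (realization K)"
    by (simp add: openin_realization_topology)
  then show "realization K \<subseteq> topspace (realization_topology K)" by (rule openin_subset)
qed

lemma topspace_orbit_space: "topspace (orbit_space G X \<phi>) = orbits G (topspace X) \<phi>"
proof
  show "topspace (orbit_space G X \<phi>) \<subseteq> orbits G (topspace X) \<phi>"
    using openin_orbit_space openin_topspace by blast
  have "{x \<in> topspace X. orbit G \<phi> x \<in> orbits G (topspace X) \<phi>} = topspace X"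
    by (auto simp: orbits_def)
  then have "openin (orbit_space G X \<phi>) (orbits G (topspace X) \<phi>)"
    by (simp add: openin_orbit_space)
  then show "orbits G (topspace X) \<phi> \<subseteq> topspace (orbit_space G X \<phi>)" by (rule openin_subset)
qed

lemma open_standard_simplex_subset: "open_standard_simplex k \<subseteq> standard_simplex k"
  by (auto simp: open_standard_simplex_def)

lemma open_standard_simplex_nonempty: "open_standard_simplex k \<noteq> {}"
proof -
  let ?x = "\<lambda>i. if i \<le> k then 1 / real (Suc k) else 0"
  have "(\<Sum>i\<le>k. ?x i) = (\<Sum>i\<le>k. 1 / real (Suc k))" by (rule sum.cong) auto
  then have "(\<Sum>i\<le>k. ?x i) = 1" by simp
  then have "?x \<in> open_standard_simplex k"
    by (auto simp: open_standard_simplex_def standard_simplex_def)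
  then show ?thesis by blast
qed

text \<open>Inserting a zero coordinate at position \<open>j\<close> has the effect of deleting the vertex at position \<open>j\<close>.\<close>

lemma simplex_point_simplical_face:
  assumes vs: "distinct vs" "length vs = Suc (Suc k)" and j: "j \<le> Suc k"
  shows "simplex_point vs (simplical_face j x) = simplex_point (take j vs @ drop (Suc j) vs) x"
proof
  fix v
  let ?ws = "take j vs @ drop (Suc j) vs"
  have split: "vs = take j vs @ vs ! j # drop (Suc j) vs"
    using j vs(2) by (simp add: id_take_nth_drop)
  have d: "distinct ?ws" "vs ! j \<notin> set ?ws" and sub: "set ?ws \<subseteq> set vs"
    using arg_cong[OF split, of set] arg_cong[OF split, of distinct] vs(1) by auto
  have len: "length ?ws = Suc k" using vs(2) j by simp
  show "simplex_point vs (simplical_face j x) v = simplex_point ?ws x v"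
  proof (cases "v \<in> set vs")
    case True
    then obtain i where i: "i < length vs" "v = vs ! i" by (auto simp: in_set_conv_nth)
    consider "i < j" | "i = j" | "i > j" by linarith
    then show ?thesis
    proof cases
      case 1
      then have "?ws ! i = v" "i < length ?ws" using i len vs j by (auto simp: nth_append)
      then show ?thesis using simplex_point_nth[OF vs(1) i(1)] simplex_point_nth[OF d(1), of i] i 1
        by (simp add: simplical_face_def del: length_append)
    next
      case 2
      then show ?thesis using simplex_point_nth[OF vs(1) i(1)] simplex_point_outside[OF d(2)] i
        by (simp add: simplical_face_def)
    next
      case 3
      then have "?ws ! (i - 1) = v" "i - 1 < length ?ws" using i len vs j by (auto simp: nth_append)
      then show ?thesis using simplex_point_nth[OF vs(1) i(1)] simplex_point_nth[OF d(1), of "i - 1"] i 3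
        by (simp add: simplical_face_def del: length_append)
    qed
  next
    case False
    then show ?thesis using sub simplex_point_outside[of v] by (metis subsetD)
  qed
qed


section \<open>The cell structure of the quotient\<close>

context garside_order
begin

abbreviation complex :: "'a set set"
  where "complex \<equiv> garside_complex G D"

abbreviation point_orbit :: "('a \<Rightarrow> real) \<Rightarrow> ('a \<Rightarrow> real) set"
  where "point_orbit \<equiv> orbit G (garside_action G D)"

lemma complex_subset: "\<lbrakk>\<sigma> \<in> complex; \<tau> \<subseteq> \<sigma>; \<tau> \<noteq> {}\<rbrakk> \<Longrightarrow> \<tau> \<in> complex"
  unfolding garside_complex_def flag_complex_def by (auto intro: finite_subset)

lemma simplex_point_in_closed:
  assumes "simple_chain vs" "length vs = Suc k" "x \<in> standard_simplex k"
  shows "simplex_point vs x \<in> closed_simplex complex (set vs)"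
proof (rule simplex_point_in_closed_simplex[OF simple_chain_distinct[OF assms(1)] assms(2,3)])
  have "set vs \<in> complex" using assms(1,2) by (auto simp: mem_garside_complex)
  then show "\<And>\<tau>. \<lbrakk>\<tau> \<subseteq> set vs; \<tau> \<noteq> {}\<rbrakk> \<Longrightarrow> \<tau> \<in> complex" using complex_subset by blast
qed

lemma support_open:
  assumes "simple_chain vs" "length vs = Suc k" "x \<in> open_standard_simplex k"
  shows "{v. simplex_point vs x v \<noteq> 0} = set vs"
proof -
  have "x i \<noteq> 0" if "i < length vs" for i
    using assms(2,3) that by (force simp: open_standard_simplex_def less_Suc_eq_le)
  then show ?thesis
    unfolding support_simplex_point[OF simple_chain_distinct[OF assms(1)]] set_conv_nth by blast
qed

lemma simplex_point_image_open:
  assumes vs: "simple_chain vs" "length vs = Suc k"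
  shows "simplex_point vs ` open_standard_simplex k = open_simplex complex (set vs)"
proof (intro subset_antisym subsetI)
  fix \<alpha> assume "\<alpha> \<in> simplex_point vs ` open_standard_simplex k"
  then obtain x where x: "x \<in> open_standard_simplex k" "\<alpha> = simplex_point vs x" by blast
  then have "x \<in> standard_simplex k" using open_standard_simplex_subset by blast
  then show "\<alpha> \<in> open_simplex complex (set vs)"
    using support_open[OF vs x(1)] simplex_point_in_closed[OF vs] x(2)
    by (simp add: open_simplex_def closed_simplex_def)
next
  fix \<alpha> assume a: "\<alpha> \<in> open_simplex complex (set vs)"
  then have c: "\<alpha> \<in> closed_simplex complex (set vs)" by (simp add: open_simplex_def closed_simplex_def)
  let ?x = "barycentric_coords vs \<alpha>"
  have d: "distinct vs" by (rule simple_chain_distinct[OF vs(1)])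
  have "simplex_point vs ?x = \<alpha>"
    using c by (intro simplex_point_barycentric_coords d) (simp add: closed_simplex_def)
  moreover have "0 < ?x i" if "i \<le> k" for i
  proof -
    have "vs ! i \<in> set vs" using that vs(2) by simp
    then have "\<alpha> (vs ! i) \<noteq> 0" "0 \<le> \<alpha> (vs ! i)"
      using a by (auto simp: open_simplex_def realization_def)
    then show ?thesis using that vs(2) by (simp add: barycentric_coords_def)
  qed
  then have "?x \<in> open_standard_simplex k"
    using barycentric_coords_in_standard_simplex[OF d vs(2) c] by (simp add: open_standard_simplex_def)
  ultimately show "\<alpha> \<in> simplex_point vs ` open_standard_simplex k" by (metis imageI)
qed

lemma action_simplex_point:
  assumes vs: "simple_chain vs" "length vs = Suc k" and x: "x \<in> standard_simplex k" and h: "h \<in> carrier G"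
  shows "garside_action G D h (simplex_point vs x) = simplex_point (map (\<lambda>v. h \<otimes> v) vs) x"
proof -
  have car: "set vs \<subseteq> carrier G" using vs by (simp add: simple_chain_def)
  have real: "simplex_point vs x \<in> realization complex"
    using simplex_point_in_closed[OF vs x] by (simp add: closed_simplex_def)
  show ?thesis
  proof
    fix v
    show "garside_action G D h (simplex_point vs x) v = simplex_point (map (\<lambda>v. h \<otimes> v) vs) x v"
    proof (cases "v \<in> carrier G")
      case True
      have "vs ! i = inv h \<otimes> v \<longleftrightarrow> h \<otimes> vs ! i = v" if "i < length vs" for i
      proof -
        have "vs ! i \<in> carrier G" using car that by (meson nth_mem subsetD)
        then show ?thesis using True h by auto
      qed
      then have "{i. i < length vs \<and> vs ! i = inv h \<otimes> v}
          = {i. i < length (map (\<lambda>v. h \<otimes> v) vs) \<and> map (\<lambda>v. h \<otimes> v) vs ! i = v}" by auto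
      then show ?thesis using True real by (simp add: garside_action_def translation_def simplex_point_def)
    next
      case False
      then have "v \<notin> set (map (\<lambda>v. h \<otimes> v) vs)" using car h by auto
      then have "simplex_point (map (\<lambda>v. h \<otimes> v) vs) x v = 0" by (rule simplex_point_outside)
      then show ?thesis using False real by (simp add: garside_action_def translation_def)
    qed
  qed
qed

lemma point_orbit_simplex_point:
  assumes "simple_chain vs" "length vs = Suc k" "x \<in> standard_simplex k"
  shows "point_orbit (simplex_point vs x) = (\<lambda>g. simplex_point (map (\<lambda>v. g \<otimes> v) vs) x) ` carrier G"
  unfolding orbit_def Setcompr_eq_image Collect_mem_eq
  by (rule image_cong) (simp_all add: action_simplex_point[OF assms])

lemma point_orbit_translate:
  assumes vs: "simple_chain vs" "length vs = Suc k" and x: "x \<in> standard_simplex k" and h: "h \<in> carrier G"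
  shows "point_orbit (simplex_point (map (\<lambda>v. h \<otimes> v) vs) x) = point_orbit (simplex_point vs x)"
proof -
  have car: "set vs \<subseteq> carrier G" using vs by (simp add: simple_chain_def)
  have comp: "map (\<lambda>v. g \<otimes> v) (map (\<lambda>v. h \<otimes> v) vs) = map (\<lambda>v. (g \<otimes> h) \<otimes> v) vs" if "g \<in> carrier G" for g
    using that h car by (auto simp: m_assoc)
  have shift: "(\<lambda>g. g \<otimes> h) ` carrier G = carrier G"
  proof (intro subset_antisym subsetI)
    fix g assume "g \<in> carrier G"
    then show "g \<in> (\<lambda>g. g \<otimes> h) ` carrier G"
      using h by (intro image_eqI[of _ _ "g \<otimes> inv h"]) (auto simp: m_assoc)
  qed (use h in auto)
  have "point_orbit (simplex_point (map (\<lambda>v. h \<otimes> v) vs) x)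
      = (\<lambda>g. simplex_point (map (\<lambda>v. g \<otimes> v) (map (\<lambda>v. h \<otimes> v) vs)) x) ` carrier G"
    using point_orbit_simplex_point[OF simple_chain_translate[OF h vs(1)] _ x] vs(2) by simp
  also have "\<dots> = (\<lambda>g. simplex_point (map (\<lambda>v. g \<otimes> v) vs) x) ` (\<lambda>g. g \<otimes> h) ` carrier G"
    unfolding image_image by (rule image_cong) (simp_all only: comp)
  finally show ?thesis using point_orbit_simplex_point[OF vs x] by (simp only: shift)
qed

lemma bar_cell_eq:
  assumes "\<mu>s \<in> simple_tuples G D k" "x \<in> standard_simplex k"
  shows "bar_cell G D k \<mu>s x = point_orbit (simplex_point (verts \<one> \<mu>s) x)"
proof -
  have "verts \<one> \<mu>s ! i = list_product G (take i \<mu>s)" if "i \<le> k" for i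
    using nth_verts[of \<one> \<mu>s i] simple_tuplesD[OF assms(1)] that list_product_closed
    by (metis l_one one_closed order.trans set_take_subset)
  then have "{i. i \<le> k \<and> list_product G (take i \<mu>s) = v} = {i. i < length (verts \<one> \<mu>s) \<and> verts \<one> \<mu>s ! i = v}" for v
    using simple_tuplesD(1)[OF assms(1)] by auto
  then show ?thesis using assms(2) by (simp add: bar_cell_def simplex_point_def)
qed

lemma tuple_chain:
  assumes "\<mu>s \<in> simple_tuples G D k"
  shows "simple_chain (verts \<one> \<mu>s)" "length (verts \<one> \<mu>s) = Suc k"
  using simple_chain_verts[OF assms one_closed] simple_tuplesD(1)[OF assms] by auto

text \<open>Two open cells meet only if they coincide: a translation carrying one point into another carries
  supports to supports, so the vertex lists correspond, and both start with the unit.\<close>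

lemma bar_cell_eqD:
  assumes \<mu>s: "\<mu>s \<in> simple_tuples G D k" and \<nu>s: "\<nu>s \<in> simple_tuples G D l"
    and x: "x \<in> open_standard_simplex k" and y: "y \<in> open_standard_simplex l"
    and eq: "bar_cell G D k \<mu>s x = bar_cell G D l \<nu>s y"
  shows "k = l \<and> \<mu>s = \<nu>s \<and> x = y"
proof -
  have xs: "x \<in> standard_simplex k" "y \<in> standard_simplex l"
    using x y open_standard_simplex_subset by auto
  have "map (\<lambda>v. \<one> \<otimes> v) (verts \<one> \<nu>s) = verts \<one> \<nu>s"
    using map_translate_verts[of \<one> \<one> \<nu>s] simple_tuplesD(4)[OF \<nu>s] by simp
  then have "simplex_point (verts \<one> \<nu>s) y \<in> point_orbit (simplex_point (verts \<one> \<nu>s) y)"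
    unfolding point_orbit_simplex_point[OF tuple_chain[OF \<nu>s] xs(2)]
    by (intro image_eqI[of _ _ \<one>]) simp_all
  then have "simplex_point (verts \<one> \<nu>s) y \<in> point_orbit (simplex_point (verts \<one> \<mu>s) x)"
    using eq bar_cell_eq[OF \<mu>s xs(1)] bar_cell_eq[OF \<nu>s xs(2)] by simp
  then obtain h where h: "h \<in> carrier G"
    and sp: "simplex_point (verts \<one> \<nu>s) y = simplex_point (map (\<lambda>v. h \<otimes> v) (verts \<one> \<mu>s)) x"
    unfolding point_orbit_simplex_point[OF tuple_chain[OF \<mu>s] xs(1)] by blast
  have hm: "simple_chain (map (\<lambda>v. h \<otimes> v) (verts \<one> \<mu>s))"
    "length (map (\<lambda>v. h \<otimes> v) (verts \<one> \<mu>s)) = Suc k"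
    using simple_chain_translate[OF h] tuple_chain[OF \<mu>s] by auto
  have "set (verts \<one> \<nu>s) = set (map (\<lambda>v. h \<otimes> v) (verts \<one> \<mu>s))"
    using support_open[OF hm x] support_open[OF tuple_chain[OF \<nu>s] y] sp by simp
  then have lists: "map (\<lambda>v. h \<otimes> v) (verts \<one> \<mu>s) = verts \<one> \<nu>s"
    using simple_chain_unique[OF tuple_chain(1)[OF \<nu>s] hm(1)] by simp
  then have "\<mu>s = \<nu>s" using map_translate_verts_eqD[OF h \<mu>s \<nu>s] by simp
  moreover have "k = l" using calculation simple_tuplesD(1)[OF \<mu>s] simple_tuplesD(1)[OF \<nu>s] by simp
  moreover have "x = y"
    using sp lists barycentric_coords_simplex_point[OF simple_chain_distinct[OF tuple_chain(1)[OF \<nu>s]]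
        tuple_chain(2)[OF \<nu>s]] xs calculation(2) by metis
  ultimately show ?thesis by blast
qed

text \<open>Every point is an interior point of the simplex spanned by its support.\<close>

lemma realization_point:
  assumes "\<alpha> \<in> realization complex"
  obtains k \<mu>s x where "\<mu>s \<in> simple_tuples G D k" "x \<in> open_standard_simplex k"
    "point_orbit \<alpha> = bar_cell G D k \<mu>s x"
proof -
  obtain vs where vs: "simple_chain vs" "vs \<noteq> []" "{v. \<alpha> v \<noteq> 0} = set vs"
    using assms by (auto simp: realization_def mem_garside_complex)
  then obtain k where k: "length vs = Suc k" by (cases vs) auto
  have "\<alpha> \<in> open_simplex complex (set vs)" using assms vs(3) by (simp add: open_simplex_def)
  then obtain x where x: "x \<in> open_standard_simplex k" "\<alpha> = simplex_point vs x"
    using simplex_point_image_open[OF vs(1) k] by blast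
  obtain h \<mu>s where h: "h \<in> carrier G" "\<mu>s \<in> simple_tuples G D k" "vs = map (\<lambda>v. h \<otimes> v) (verts \<one> \<mu>s)"
    using simple_chain_translate_to_verts[OF vs(1) k] .
  have "x \<in> standard_simplex k" using x(1) open_standard_simplex_subset by blast
  then have "point_orbit \<alpha> = bar_cell G D k \<mu>s x"
    using point_orbit_translate[OF tuple_chain[OF h(2)] _ h(1)] bar_cell_eq[OF h(2)] x(2) h(3) by simp
  then show thesis using that h(2) x(1) by blast
qed

lemma topspace_garside_quotient: "topspace (garside_quotient G D) = point_orbit ` realization complex"
  unfolding garside_quotient_def topspace_orbit_space by (auto simp: orbits_def)

lemma openin_garside_quotient:
  "openin (garside_quotient G D) U \<longleftrightarrow> U \<subseteq> topspace (garside_quotient G D) \<and>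
    (\<forall>\<sigma>\<in>complex. openin (top_of_set (closed_simplex complex \<sigma>))
      {\<alpha> \<in> closed_simplex complex \<sigma>. point_orbit \<alpha> \<in> U})"
proof -
  have "{\<alpha> \<in> realization complex. point_orbit \<alpha> \<in> U} \<inter> closed_simplex complex \<sigma>
      = {\<alpha> \<in> closed_simplex complex \<sigma>. point_orbit \<alpha> \<in> U}" for \<sigma>
    by (auto simp: closed_simplex_def)
  then show ?thesis
    unfolding topspace_garside_quotient
    by (auto simp: garside_quotient_def openin_orbit_space openin_realization_topology orbits_def)
qed

text \<open>Openness in the quotient is tested on the closed simplices. Each of them is a translate of the
  simplex of a tuple and is homeomorphic to a standard simplex by barycentric coordinates, so testing on
  the characteristic maps amounts to the same.\<close>

lemma openin_garside_quotient_cells: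
  assumes U: "U \<subseteq> topspace (garside_quotient G D)"
  shows "openin (garside_quotient G D) U \<longleftrightarrow>
    (\<forall>k. \<forall>\<mu>s\<in>simple_tuples G D k. openin (subtopology (powertop_real UNIV) (standard_simplex k))
      {x \<in> standard_simplex k. bar_cell G D k \<mu>s x \<in> U})"
  (is "_ \<longleftrightarrow> ?cells")
proof
  assume op: "openin (garside_quotient G D) U"
  show ?cells
  proof (intro allI ballI)
    fix k \<mu>s assume \<mu>s: "\<mu>s \<in> simple_tuples G D k"
    let ?vs = "verts \<one> \<mu>s"
    let ?c = "closed_simplex complex (set ?vs)"
    have "set ?vs \<in> complex"
      unfolding mem_garside_complex using tuple_chain(1)[OF \<mu>s] by (intro exI[of _ ?vs]) simp
    then have "openin (top_of_set ?c) {\<alpha> \<in> ?c. point_orbit \<alpha> \<in> U}"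
      using op openin_garside_quotient by blast
    moreover have "continuous_map (top_of_set (standard_simplex k)) (top_of_set ?c) (simplex_point ?vs)"
      using simplex_point_in_closed[OF tuple_chain[OF \<mu>s]] continuous_on_simplex_point
      by (auto simp: continuous_map_in_subtopology)
    ultimately have "openin (top_of_set (standard_simplex k))
        {x \<in> standard_simplex k. simplex_point ?vs x \<in> {\<alpha> \<in> ?c. point_orbit \<alpha> \<in> U}}"
      by (rule openin_top_of_set_preimage[rotated])
    moreover have "{x \<in> standard_simplex k. simplex_point ?vs x \<in> {\<alpha> \<in> ?c. point_orbit \<alpha> \<in> U}}
        = {x \<in> standard_simplex k. bar_cell G D k \<mu>s x \<in> U}"
      using simplex_point_in_closed[OF tuple_chain[OF \<mu>s]] bar_cell_eq[OF \<mu>s] by auto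
    ultimately show "openin (subtopology (powertop_real UNIV) (standard_simplex k))
        {x \<in> standard_simplex k. bar_cell G D k \<mu>s x \<in> U}"
      by (simp add: standard_simplex_topology)
  qed
next
  assume cells: ?cells
  show "openin (garside_quotient G D) U"
    unfolding openin_garside_quotient
  proof (intro conjI ballI U)
    fix \<sigma> assume "\<sigma> \<in> complex"
    then obtain vs where vs: "simple_chain vs" "vs \<noteq> []" "\<sigma> = set vs" by (auto simp: mem_garside_complex)
    then obtain k where k: "length vs = Suc k" by (cases vs) auto
    obtain h \<mu>s where h: "h \<in> carrier G" "\<mu>s \<in> simple_tuples G D k" "vs = map (\<lambda>v. h \<otimes> v) (verts \<one> \<mu>s)"
      using simple_chain_translate_to_verts[OF vs(1) k] .
    let ?c = "closed_simplex complex \<sigma>"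
    have d: "distinct vs" by (rule simple_chain_distinct[OF vs(1)])
    have coords: "barycentric_coords vs \<alpha> \<in> standard_simplex k" if "\<alpha> \<in> ?c" for \<alpha>
      using barycentric_coords_in_standard_simplex[OF d k] that vs(3) by simp
    have orb: "point_orbit \<alpha> = bar_cell G D k \<mu>s (barycentric_coords vs \<alpha>)" if "\<alpha> \<in> ?c" for \<alpha>
    proof -
      have "simplex_point vs (barycentric_coords vs \<alpha>) = \<alpha>"
        using that vs(3) by (intro simplex_point_barycentric_coords d) (simp add: closed_simplex_def)
      then show ?thesis
        using point_orbit_translate[OF tuple_chain[OF h(2)] coords[OF that] h(1)]
          bar_cell_eq[OF h(2) coords[OF that]] h(3) by simp
    qed
    have "continuous_map (top_of_set ?c) (top_of_set (standard_simplex k)) (barycentric_coords vs)"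
      using coords continuous_on_barycentric_coords by (auto simp: continuous_map_in_subtopology)
    moreover have "openin (top_of_set (standard_simplex k)) {x \<in> standard_simplex k. bar_cell G D k \<mu>s x \<in> U}"
      using cells h(2) by (simp add: standard_simplex_topology)
    ultimately have "openin (top_of_set ?c)
        {\<alpha> \<in> ?c. barycentric_coords vs \<alpha> \<in> {x \<in> standard_simplex k. bar_cell G D k \<mu>s x \<in> U}}"
      by (rule openin_top_of_set_preimage)
    moreover have "{\<alpha> \<in> ?c. barycentric_coords vs \<alpha> \<in> {x \<in> standard_simplex k. bar_cell G D k \<mu>s x \<in> U}}
        = {\<alpha> \<in> ?c. point_orbit \<alpha> \<in> U}"
      using coords orb by auto
    ultimately show "openin (top_of_set ?c) {\<alpha> \<in> ?c. point_orbit \<alpha> \<in> U}" by simp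
  qed
qed

lemma singular_simplex_bar_cell:
  assumes \<mu>s: "\<mu>s \<in> simple_tuples G D k"
  shows "singular_simplex k (garside_quotient G D) (bar_cell G D k \<mu>s)"
proof -
  have in_top: "bar_cell G D k \<mu>s x \<in> topspace (garside_quotient G D)" if "x \<in> standard_simplex k" for x
    using simplex_point_in_closed[OF tuple_chain[OF \<mu>s] that] bar_cell_eq[OF \<mu>s that]
    by (auto simp: topspace_garside_quotient closed_simplex_def)
  have "continuous_map (subtopology (powertop_real UNIV) (standard_simplex k)) (garside_quotient G D) (bar_cell G D k \<mu>s)"
    unfolding continuous_map_def topspace_standard_simplex
  proof (intro conjI allI impI)
    fix U assume U: "openin (garside_quotient G D) U"
    then show "openin (subtopology (powertop_real UNIV) (standard_simplex k))
        {x \<in> standard_simplex k. bar_cell G D k \<mu>s x \<in> U}"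
      using openin_garside_quotient_cells[OF openin_subset[OF U]] \<mu>s by blast
  qed (use in_top in blast)
  moreover have "bar_cell G D k \<mu>s \<in> extensional (standard_simplex k)"
    by (simp add: bar_cell_def)
  ultimately show ?thesis by (simp add: singular_simplex_def)
qed

text \<open>Deleting a vertex leaves a chain, which is a translate of the chain of a tuple. The translation is
  nontrivial only when the vertex deleted is the first one.\<close>

lemma face_bar_cell:
  assumes \<mu>s: "\<mu>s \<in> simple_tuples G D (Suc k)" and j: "j \<le> Suc k"
  shows "\<exists>\<nu>s\<in>simple_tuples G D k. singular_face (Suc k) j (bar_cell G D (Suc k) \<mu>s) = bar_cell G D k \<nu>s"
proof -
  let ?vs = "verts \<one> \<mu>s"
  let ?ws = "take j ?vs @ drop (Suc j) ?vs"
  have len: "length ?vs = Suc (Suc k)" by (rule tuple_chain(2)[OF \<mu>s])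
  have split: "simple_chain (take j ?vs @ [?vs ! j] @ drop (Suc j) ?vs)"
    using tuple_chain(1)[OF \<mu>s] j len by (simp add: id_take_nth_drop[symmetric])
  have ws: "simple_chain ?ws" "length ?ws = Suc k"
    using simple_chain_sublist[OF split] len j by auto
  obtain h \<nu>s where h: "h \<in> carrier G" "\<nu>s \<in> simple_tuples G D k" "?ws = map (\<lambda>v. h \<otimes> v) (verts \<one> \<nu>s)"
    using simple_chain_translate_to_verts[OF ws] .
  have "singular_face (Suc k) j (bar_cell G D (Suc k) \<mu>s) = bar_cell G D k \<nu>s"
  proof
    fix x
    show "singular_face (Suc k) j (bar_cell G D (Suc k) \<mu>s) x = bar_cell G D k \<nu>s x"
    proof (cases "x \<in> standard_simplex k")
      case True
      then have fx: "simplical_face j x \<in> standard_simplex (Suc k)"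
        using simplical_face_in_standard_simplex[of "Suc k" j x] j by simp
      have "singular_face (Suc k) j (bar_cell G D (Suc k) \<mu>s) x
          = point_orbit (simplex_point ?vs (simplical_face j x))"
        using True fx by (simp add: singular_face_def bar_cell_eq[OF \<mu>s])
      also have "\<dots> = point_orbit (simplex_point ?ws x)"
        using simplex_point_simplical_face[OF simple_chain_distinct[OF tuple_chain(1)[OF \<mu>s]] len j] by simp
      also have "\<dots> = bar_cell G D k \<nu>s x"
        using point_orbit_translate[OF tuple_chain[OF h(2)] True h(1)] bar_cell_eq[OF h(2) True] h(3) by simp
      finally show ?thesis .
    next
      case False
      then show ?thesis by (simp add: singular_face_def bar_cell_def)
    qed
  qed
  then show ?thesis using h(2) by blast
qed

theorem delta_complex_structure_quotient:
  "delta_complex_structure (garside_quotient G D) (simple_tuples G D) (bar_cell G D)"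
  unfolding delta_complex_structure_def
proof (intro conjI allI ballI impI)
  fix k \<mu>s assume \<mu>s: "\<mu>s \<in> simple_tuples G D k"
  show "singular_simplex k (garside_quotient G D) (bar_cell G D k \<mu>s)"
    by (rule singular_simplex_bar_cell[OF \<mu>s])
  show "inj_on (bar_cell G D k \<mu>s) (open_standard_simplex k)"
    using bar_cell_eqD[OF \<mu>s \<mu>s] by (intro inj_onI) blast
next
  fix p assume "p \<in> topspace (garside_quotient G D)"
  then obtain \<alpha> where "\<alpha> \<in> realization complex" "p = point_orbit \<alpha>"
    by (auto simp: topspace_garside_quotient)
  then obtain k \<mu>s x where p: "\<mu>s \<in> simple_tuples G D k" "x \<in> open_standard_simplex k"
    "p = bar_cell G D k \<mu>s x"
    using realization_point by metis
  show "\<exists>!c. c \<in> Sigma UNIV (simple_tuples G D) \<and>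
      p \<in> bar_cell G D (fst c) (snd c) ` open_standard_simplex (fst c)"
  proof (rule ex1I[of _ "(k, \<mu>s)"])
    fix c assume c: "c \<in> Sigma UNIV (simple_tuples G D) \<and>
      p \<in> bar_cell G D (fst c) (snd c) ` open_standard_simplex (fst c)"
    then obtain y where "y \<in> open_standard_simplex (fst c)" "p = bar_cell G D (fst c) (snd c) y" by blast
    then show "c = (k, \<mu>s)" using bar_cell_eqD[OF p(1) _ p(2), of "snd c" "fst c" y] c p(3)
      by (auto simp: prod_eq_iff)
  qed (use p in auto)
next
  fix k \<mu>s j assume "\<mu>s \<in> simple_tuples G D (Suc k)" "j \<le> Suc k"
  then show "\<exists>\<nu>s\<in>simple_tuples G D k. singular_face (Suc k) j (bar_cell G D (Suc k) \<mu>s) = bar_cell G D k \<nu>s"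
    by (rule face_bar_cell)
next
  fix U assume "U \<subseteq> topspace (garside_quotient G D)"
  then show "openin (garside_quotient G D) U \<longleftrightarrow>
    (\<forall>k. \<forall>\<mu>s\<in>simple_tuples G D k. openin (subtopology (powertop_real UNIV) (standard_simplex k))
      {x \<in> standard_simplex k. bar_cell G D k \<mu>s x \<in> U})"
    by (rule openin_garside_quotient_cells)
qed

lemma bar_cell_image_open:
  assumes \<mu>s: "\<mu>s \<in> simple_tuples G D k" and h: "h \<in> carrier G"
  shows "bar_cell G D k \<mu>s ` open_standard_simplex k
    = point_orbit ` open_simplex complex (set (map (\<lambda>v. h \<otimes> v) (verts \<one> \<mu>s)))"
proof -
  have hm: "simple_chain (map (\<lambda>v. h \<otimes> v) (verts \<one> \<mu>s))"
    "length (map (\<lambda>v. h \<otimes> v) (verts \<one> \<mu>s)) = Suc k"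
    using simple_chain_translate[OF h] tuple_chain[OF \<mu>s] by auto
  have "bar_cell G D k \<mu>s x = point_orbit (simplex_point (map (\<lambda>v. h \<otimes> v) (verts \<one> \<mu>s)) x)"
    if "x \<in> open_standard_simplex k" for x
    using that open_standard_simplex_subset bar_cell_eq[OF \<mu>s]
      point_orbit_translate[OF tuple_chain[OF \<mu>s] _ h] by (metis subsetD)
  then show ?thesis
    unfolding simplex_point_image_open[OF hm, symmetric] image_image by (intro image_cong) auto
qed

theorem bij_betw_quotient_cells:
  "bij_betw (\<lambda>\<mu>s. bar_cell G D k \<mu>s ` open_standard_simplex k)
    (simple_tuples G D k) (quotient_cells G D k)"
  unfolding bij_betw_def
proof
  show "inj_on (\<lambda>\<mu>s. bar_cell G D k \<mu>s ` open_standard_simplex k) (simple_tuples G D k)"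
  proof (rule inj_onI)
    fix \<mu>s \<nu>s assume t: "\<mu>s \<in> simple_tuples G D k" "\<nu>s \<in> simple_tuples G D k"
      and eq: "bar_cell G D k \<mu>s ` open_standard_simplex k = bar_cell G D k \<nu>s ` open_standard_simplex k"
    obtain x where x: "x \<in> open_standard_simplex k" using open_standard_simplex_nonempty by blast
    then have "bar_cell G D k \<mu>s x \<in> bar_cell G D k \<nu>s ` open_standard_simplex k" using eq by blast
    then obtain y where "y \<in> open_standard_simplex k" "bar_cell G D k \<mu>s x = bar_cell G D k \<nu>s y" by blast
    then show "\<mu>s = \<nu>s" using bar_cell_eqD[OF t x] by blast
  qed
  show "(\<lambda>\<mu>s. bar_cell G D k \<mu>s ` open_standard_simplex k) ` simple_tuples G D k = quotient_cells G D k"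
  proof (intro subset_antisym subsetI)
    fix c assume "c \<in> (\<lambda>\<mu>s. bar_cell G D k \<mu>s ` open_standard_simplex k) ` simple_tuples G D k"
    then obtain \<mu>s where \<mu>s: "\<mu>s \<in> simple_tuples G D k" "c = bar_cell G D k \<mu>s ` open_standard_simplex k"
      by blast
    let ?vs = "map (\<lambda>v. \<one> \<otimes> v) (verts \<one> \<mu>s)"
    have ch: "simple_chain ?vs" "length ?vs = Suc k"
      using simple_chain_translate[OF one_closed tuple_chain(1)] tuple_chain(2) \<mu>s(1) by auto
    then have "?vs \<noteq> []" "card (set ?vs) = Suc k"
      using distinct_card[OF simple_chain_distinct[OF ch(1)]] by auto
    moreover have "set ?vs \<in> complex" using ch(1) calculation(1) mem_garside_complex by blast
    ultimately show "c \<in> quotient_cells G D k"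
      using \<mu>s(2) bar_cell_image_open[OF \<mu>s(1) one_closed] unfolding quotient_cells_def by blast
  next
    fix c assume "c \<in> quotient_cells G D k"
    then obtain \<sigma> where \<sigma>: "\<sigma> \<in> complex" "card \<sigma> = Suc k" "c = point_orbit ` open_simplex complex \<sigma>"
      unfolding quotient_cells_def by blast
    then obtain vs where vs: "simple_chain vs" "\<sigma> = set vs" by (auto simp: mem_garside_complex)
    then have "length vs = Suc k" using \<sigma>(2) distinct_card[OF simple_chain_distinct] by metis
    then obtain h \<mu>s where "h \<in> carrier G" "\<mu>s \<in> simple_tuples G D k" "vs = map (\<lambda>v. h \<otimes> v) (verts \<one> \<mu>s)"
      using simple_chain_translate_to_verts[OF vs(1)] by metis
    then show "c \<in> (\<lambda>\<mu>s. bar_cell G D k \<mu>s ` open_standard_simplex k) ` simple_tuples G D k"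
      using bar_cell_image_open \<sigma>(3) vs(2) by blast
  qed
qed

end


section \<open>The group ring and free modules\<close>

text \<open>The bilinear extension of an operation on basis elements. It covers the product of the group ring
  (for the product of \<open>G\<close>) and the module structure of the chain groups (for the translation of
  vertex lists).\<close>

definition frag_act :: "('g \<Rightarrow> 'x \<Rightarrow> 'y) \<Rightarrow> ('g \<Rightarrow>\<^sub>0 int) \<Rightarrow> ('x \<Rightarrow>\<^sub>0 int) \<Rightarrow> ('y \<Rightarrow>\<^sub>0 int)"
  where "frag_act f a z = frag_extend (\<lambda>g. frag_extend (\<lambda>x. frag_of (f g x)) z) a"

lemma frag_act_of [simp]:
  "frag_act f (frag_of g) z = frag_extend (\<lambda>x. frag_of (f g x)) z"
  by (simp add: frag_act_def)

lemma frag_act_left: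
  "frag_act f 0 z = 0" "frag_act f (a - b) z = frag_act f a z - frag_act f b z"
  "frag_act f (a + b) z = frag_act f a z + frag_act f b z"
  by (simp_all add: frag_act_def frag_extend_diff frag_extend_add)

lemma frag_act_right:
  "frag_act f a 0 = 0" "frag_act f a (z - w) = frag_act f a z - frag_act f a w"
  "frag_act f a (z + w) = frag_act f a z + frag_act f a w"
  by (induction a rule: frag_induction[OF subset_UNIV])
    (simp_all add: frag_act_left frag_extend_diff frag_extend_add)

lemma frag_act_sum:
  "finite I \<Longrightarrow> frag_act f a (\<Sum>i\<in>I. z i) = (\<Sum>i\<in>I. frag_act f a (z i))"
  by (induction I rule: finite_induct) (simp_all add: frag_act_right)

lemma keys_frag_act:
  "Poly_Mapping.keys (frag_act f a z) \<subseteq> (\<Union>g\<in>Poly_Mapping.keys a. f g ` Poly_Mapping.keys z)"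
proof
  fix y assume "y \<in> Poly_Mapping.keys (frag_act f a z)"
  then obtain g where g: "g \<in> Poly_Mapping.keys a" "y \<in> Poly_Mapping.keys (frag_extend (\<lambda>x. frag_of (f g x)) z)"
    using keys_frag_extend[of "\<lambda>g. frag_extend (\<lambda>x. frag_of (f g x)) z" a] unfolding frag_act_def by blast
  then obtain x where "x \<in> Poly_Mapping.keys z" "y = f g x"
    using keys_frag_extend[of "\<lambda>x. frag_of (f g x)" z] by auto
  then show "y \<in> (\<Union>g\<in>Poly_Mapping.keys a. f g ` Poly_Mapping.keys z)" using g by blast
qed

lemma frag_act_natural:
  assumes a: "Poly_Mapping.keys a \<subseteq> A" and z: "Poly_Mapping.keys z \<subseteq> Z"
    and nat: "\<And>g x. \<lbrakk>g \<in> A; x \<in> Z\<rbrakk> \<Longrightarrow> k (f g x) = frag_extend (\<lambda>y. frag_of (f' g y)) (k x)"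
  shows "frag_extend k (frag_act f a z) = frag_act f' a (frag_extend k z)"
  using a
proof (induction a rule: frag_induction)
  case (one g)
  have "frag_extend k (frag_extend (\<lambda>x. frag_of (f g x)) z)
      = frag_extend (\<lambda>y. frag_of (f' g y)) (frag_extend k z)"
    using z by (induction z rule: frag_induction) (simp_all add: frag_extend_diff nat one)
  then show ?case by simp
qed (simp_all add: frag_act_left frag_extend_diff)

lemma frag_act_assoc:
  assumes a: "Poly_Mapping.keys a \<subseteq> A" and b: "Poly_Mapping.keys b \<subseteq> A" and z: "Poly_Mapping.keys z \<subseteq> Z"
    and assoc: "\<And>g h x. \<lbrakk>g \<in> A; h \<in> A; x \<in> Z\<rbrakk> \<Longrightarrow> f (m g h) x = f g (f h x)"
  shows "frag_act f (frag_act m a b) z = frag_act f a (frag_act f b z)"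
proof -
  have "frag_act f (frag_act m a b) z = frag_extend (\<lambda>h. frag_extend (\<lambda>x. frag_of (f h x)) z) (frag_act m a b)"
    by (simp only: frag_act_def)
  also have "\<dots> = frag_act f a (frag_extend (\<lambda>h. frag_extend (\<lambda>x. frag_of (f h x)) z) b)"
  proof (rule frag_act_natural[OF a b])
    fix g h assume gh: "g \<in> A" "h \<in> A"
    show "frag_extend (\<lambda>x. frag_of (f (m g h) x)) z
        = frag_extend (\<lambda>y. frag_of (f g y)) (frag_extend (\<lambda>x. frag_of (f h x)) z)"
      using z by (induction z rule: frag_induction) (simp_all add: frag_extend_diff assoc gh)
  qed
  finally show ?thesis by (simp only: frag_act_def)
qed

lemma group_ring_simps [simp]:
  "carrier (group_ring G) = {a. Poly_Mapping.keys a \<subseteq> carrier G}"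
  "a \<otimes>\<^bsub>group_ring G\<^esub> b = frag_act (\<lambda>g h. g \<otimes>\<^bsub>G\<^esub> h) a b"
  "\<one>\<^bsub>group_ring G\<^esub> = frag_of \<one>\<^bsub>G\<^esub>"
  "\<zero>\<^bsub>group_ring G\<^esub> = 0"
  "a \<oplus>\<^bsub>group_ring G\<^esub> b = a + b"
  by (simp_all add: group_ring_def frag_act_def)

lemma frag_extend_id_on:
  assumes "Poly_Mapping.keys z \<subseteq> Z" "\<And>x. x \<in> Z \<Longrightarrow> f x = x"
  shows "frag_extend (\<lambda>x. frag_of (f x)) z = z"
  using assms(1) by (induction z rule: frag_induction) (simp_all add: frag_extend_diff assms(2))

lemma (in group) ring_group_ring: "ring (group_ring G)"
proof (rule ringI)
  show "abelian_group (group_ring G)"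
  proof (rule abelian_groupI)
    fix x assume "x \<in> carrier (group_ring G)"
    then show "\<exists>y\<in>carrier (group_ring G). y \<oplus>\<^bsub>group_ring G\<^esub> x = \<zero>\<^bsub>group_ring G\<^esub>"
      by (intro bexI[of _ "- x"]) auto
  qed (use keys_add in \<open>fastforce simp: algebra_simps\<close>)+
  show "monoid (group_ring G)"
  proof (rule monoidI)
    fix x y assume "x \<in> carrier (group_ring G)" "y \<in> carrier (group_ring G)"
    then show "x \<otimes>\<^bsub>group_ring G\<^esub> y \<in> carrier (group_ring G)"
      using keys_frag_act[of "\<lambda>g h. g \<otimes> h" x y] by fastforce
  next
    fix x y z
    assume "x \<in> carrier (group_ring G)" "y \<in> carrier (group_ring G)" "z \<in> carrier (group_ring G)"
    then show "x \<otimes>\<^bsub>group_ring G\<^esub> y \<otimes>\<^bsub>group_ring G\<^esub> z = x \<otimes>\<^bsub>group_ring G\<^esub> (y \<otimes>\<^bsub>group_ring G\<^esub> z)"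
      using frag_act_assoc[of x "carrier G" y z "carrier G" "\<lambda>g h. g \<otimes> h" "\<lambda>g h. g \<otimes> h"]
      by (simp add: m_assoc)
  next
    fix x assume x: "x \<in> carrier (group_ring G)"
    then show "\<one>\<^bsub>group_ring G\<^esub> \<otimes>\<^bsub>group_ring G\<^esub> x = x"
      by (simp add: frag_extend_id_on[of x "carrier G"])
    show "x \<otimes>\<^bsub>group_ring G\<^esub> \<one>\<^bsub>group_ring G\<^esub> = x"
      using x frag_extend_id_on[of x "carrier G" "\<lambda>g. g \<otimes> \<one>"] by (simp add: frag_act_def)
  qed simp
qed (simp_all add: frag_act_left frag_act_right)

lemma frag_extend_augmentation:
  "frag_extend (\<lambda>x. frag_of c) a = frag_cmul (augmentation a) (frag_of c)"
  by (rule poly_mapping_eqI) (simp add: frag_extend_def augmentation_def lookup_sum sum_distrib_right)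

text \<open>The augmentation is the linear extension of a constant; in this form its additivity is that of
  \<open>frag_extend\<close>.\<close>

lemma augmentation_eq: "augmentation a = Poly_Mapping.lookup (frag_extend (\<lambda>x. frag_of ()) a) ()"
  by (simp add: frag_extend_augmentation)

lemma augmentation_simps:
  "augmentation 0 = 0" "augmentation (frag_of g) = 1"
  "augmentation (a + b) = augmentation a + augmentation b"
  "augmentation (a - b) = augmentation a - augmentation b"
  "augmentation (frag_cmul n a) = n * augmentation a"
  by (simp_all add: augmentation_eq frag_extend_add frag_extend_diff frag_extend_cmul lookup_add lookup_minus)

lemma augmentation_frag_act: "augmentation (frag_act f a b) = augmentation a * augmentation b"
proof (induction a rule: frag_induction[OF subset_UNIV])
  case (2 g)
  have "augmentation (frag_extend (\<lambda>x. frag_of (f g x)) b) = augmentation b"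
    by (induction b rule: frag_induction[OF subset_UNIV]) (simp_all add: frag_extend_diff augmentation_simps)
  then show ?case by (simp add: augmentation_simps)
qed (simp_all add: frag_act_left augmentation_simps left_diff_distrib)

lemma (in group) left_module_trivial: "left_module (group_ring G) trivial_module"
proof (intro left_module.intro left_module_axioms.intro)
  show "ring (group_ring G)" by (rule ring_group_ring)
  show "abelian_group (trivial_module :: ('a \<Rightarrow>\<^sub>0 int, int) module)"
  proof (rule abelian_groupI)
    fix x :: int
    show "\<exists>y\<in>carrier trivial_module. y \<oplus>\<^bsub>trivial_module\<^esub> x = \<zero>\<^bsub>trivial_module\<^esub>"
      by (intro bexI[of _ "- x"]) (simp_all add: trivial_module_def)
  qed (simp_all add: trivial_module_def)
qed (simp_all add: trivial_module_def augmentation_simps augmentation_frag_act algebra_simps)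

lemma (in ring) left_module_free_module: "left_module R (free_module R n)"
proof (intro left_module.intro left_module_axioms.intro)
  show "ring R" by (rule ring_axioms)
  show "abelian_group (free_module R n)"
  proof (rule abelian_groupI)
    fix x assume x: "x \<in> carrier (free_module R n)"
    then show "\<exists>y\<in>carrier (free_module R n). y \<oplus>\<^bsub>free_module R n\<^esub> x = \<zero>\<^bsub>free_module R n\<^esub>"
      by (intro bexI[of _ "\<lambda>i\<in>{..<n}. \<ominus> x i"])
        (auto simp: free_module_def PiE_iff fun_eq_iff l_neg)
  qed (auto simp: free_module_def PiE_iff fun_eq_iff a_ac extensional_def)
qed (auto simp: free_module_def PiE_iff fun_eq_iff extensional_def l_distr r_distr m_assoc)


section \<open>The resolution\<close>

context garside_order
begin

definition chains :: "nat \<Rightarrow> 'a list set"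
  where "chains k = {vs. simple_chain vs \<and> length vs = Suc k}"

abbreviation cell_count :: "nat \<Rightarrow> nat"
  where "cell_count k \<equiv> card (simple_tuples G D k)"

abbreviation free_term :: "nat \<Rightarrow> ('a \<Rightarrow>\<^sub>0 int, nat \<Rightarrow> ('a \<Rightarrow>\<^sub>0 int)) module"
  where "free_term k \<equiv> free_module (group_ring G) (cell_count k)"

definition tuple :: "nat \<Rightarrow> nat \<Rightarrow> 'a list"
  where "tuple k = (SOME e. bij_betw e {..<cell_count k} (simple_tuples G D k))"

lemma bij_betw_tuple: "bij_betw (tuple k) {..<cell_count k} (simple_tuples G D k)"
  unfolding tuple_def
  by (rule someI_ex[OF ex_bij_betw_nat_finite[OF finite_simple_tuples, unfolded atLeast0LessThan]])

lemma tuple_in: "i < cell_count k \<Longrightarrow> tuple k i \<in> simple_tuples G D k"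
  using bij_betw_apply[OF bij_betw_tuple] by (meson lessThan_iff)

text \<open>The isomorphism of the free module on the \<open>k\<close>-tuples with the group of \<open>k\<close>-chains: the basis element
  of a tuple \<open>\<mu>s\<close> goes to the chain \<open>verts \<one> \<mu>s\<close>. In the inverse, the coefficient at \<open>\<mu>s\<close> collects
  the least vertices of the simplices with steps \<open>\<mu>s\<close>.\<close>

definition to_chain :: "nat \<Rightarrow> (nat \<Rightarrow> ('a \<Rightarrow>\<^sub>0 int)) \<Rightarrow> ('a list \<Rightarrow>\<^sub>0 int)"
  where "to_chain k x = (\<Sum>i<cell_count k. frag_extend (\<lambda>g. frag_of (verts g (tuple k i))) (x i))"

definition coefficient :: "'a list \<Rightarrow> ('a list \<Rightarrow>\<^sub>0 int) \<Rightarrow> ('a \<Rightarrow>\<^sub>0 int)"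
  where "coefficient \<mu>s = frag_extend (\<lambda>vs. if steps vs = \<mu>s then frag_of (hd vs) else 0)"

definition of_chain :: "nat \<Rightarrow> ('a list \<Rightarrow>\<^sub>0 int) \<Rightarrow> nat \<Rightarrow> ('a \<Rightarrow>\<^sub>0 int)"
  where "of_chain k z = (\<lambda>i\<in>{..<cell_count k}. coefficient (tuple k i) z)"

abbreviation chain_act :: "('a \<Rightarrow>\<^sub>0 int) \<Rightarrow> ('a list \<Rightarrow>\<^sub>0 int) \<Rightarrow> ('a list \<Rightarrow>\<^sub>0 int)"
  where "chain_act \<equiv> frag_act (\<lambda>h. map (\<lambda>v. h \<otimes> v))"

lemma mem_free_term:
  "x \<in> carrier (free_term k) \<longleftrightarrow> x \<in> extensional {..<cell_count k} \<and> (\<forall>i<cell_count k. Poly_Mapping.keys (x i) \<subseteq> carrier G)"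
  by (auto simp: free_module_def PiE_iff)

lemma to_chain_in:
  assumes "x \<in> carrier (free_term k)"
  shows "Poly_Mapping.keys (to_chain k x) \<subseteq> chains k"
proof
  fix vs assume "vs \<in> Poly_Mapping.keys (to_chain k x)"
  then obtain i where i: "i < cell_count k"
    "vs \<in> Poly_Mapping.keys (frag_extend (\<lambda>g. frag_of (verts g (tuple k i))) (x i))"
    using keys_sum[of "\<lambda>i. frag_extend (\<lambda>g. frag_of (verts g (tuple k i))) (x i)" "{..<cell_count k}"]
    unfolding to_chain_def by blast
  then obtain g where "g \<in> Poly_Mapping.keys (x i)" "vs = verts g (tuple k i)"
    using keys_frag_extend[of "\<lambda>g. frag_of (verts g (tuple k i))" "x i"] by auto
  moreover have "g \<in> carrier G" using assms i(1) calculation(1) by (auto simp: mem_free_term)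
  ultimately show "vs \<in> chains k"
    using simple_chain_verts[OF tuple_in[OF i(1)]] simple_tuplesD(1)[OF tuple_in[OF i(1)]]
    by (simp add: chains_def)
qed

lemma of_chain_in:
  assumes "Poly_Mapping.keys z \<subseteq> chains k"
  shows "of_chain k z \<in> carrier (free_term k)"
proof -
  have "Poly_Mapping.keys (coefficient \<mu>s z) \<subseteq> carrier G" for \<mu>s
  proof
    fix g assume "g \<in> Poly_Mapping.keys (coefficient \<mu>s z)"
    then obtain vs where "vs \<in> Poly_Mapping.keys z" "g = hd vs"
      using keys_frag_extend[of "\<lambda>vs. if steps vs = \<mu>s then frag_of (hd vs) else 0" z]
      by (auto simp: coefficient_def split: if_splits)
    then have "vs \<in> chains k" "g = hd vs" using assms by auto
    then show "g \<in> carrier G" by (cases vs) (auto simp: chains_def simple_chain_def)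
  qed
  then show ?thesis by (simp add: mem_free_term of_chain_def)
qed

lemma coefficient_verts:
  assumes "Poly_Mapping.keys a \<subseteq> carrier G" "set \<nu>s \<subseteq> carrier G"
  shows "coefficient \<mu>s (frag_extend (\<lambda>g. frag_of (verts g \<nu>s)) a) = (if \<mu>s = \<nu>s then a else 0)"
  using assms(1)
  by (induction a rule: frag_induction)
    (auto simp: coefficient_def frag_extend_diff steps_verts assms(2))

lemma of_chain_to_chain:
  assumes x: "x \<in> carrier (free_term k)"
  shows "of_chain k (to_chain k x) = x"
proof
  fix i
  show "of_chain k (to_chain k x) i = x i"
  proof (cases "i < cell_count k")
    case True
    have "coefficient (tuple k i) (to_chain k x)
        = (\<Sum>j<cell_count k. coefficient (tuple k i) (frag_extend (\<lambda>g. frag_of (verts g (tuple k j))) (x j)))"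
      unfolding to_chain_def coefficient_def by (simp add: frag_extend_sum comp_def)
    also have "\<dots> = (\<Sum>j<cell_count k. if i = j then x j else 0)"
    proof (rule sum.cong)
      fix j assume "j \<in> {..<cell_count k}"
      then have j: "j < cell_count k" by simp
      have "tuple k i = tuple k j \<longleftrightarrow> i = j"
        using True j bij_betw_imp_inj_on[OF bij_betw_tuple[of k]] by (auto simp: inj_on_eq_iff)
      then show "coefficient (tuple k i) (frag_extend (\<lambda>g. frag_of (verts g (tuple k j))) (x j))
          = (if i = j then x j else 0)"
        using x j simple_tuplesD(4)[OF tuple_in[OF j]] by (simp add: coefficient_verts mem_free_term)
    qed simp
    finally show ?thesis using True by (simp add: of_chain_def)
  next
    case False
    then show ?thesis using x by (simp add: of_chain_def mem_free_term extensional_def)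
  qed
qed

lemma to_chain_of_chain:
  assumes z: "Poly_Mapping.keys z \<subseteq> chains k"
  shows "to_chain k (of_chain k z) = z"
proof -
  let ?t = "\<lambda>z. \<Sum>i<cell_count k. frag_extend (\<lambda>g. frag_of (verts g (tuple k i))) (coefficient (tuple k i) z)"
  have "?t z = z"
    using z
  proof (induction z rule: frag_induction)
    case zero
    then show ?case by (simp add: coefficient_def)
  next
    case (one vs)
    then have vs: "simple_chain vs" "length vs = Suc k" by (auto simp: chains_def)
    then have ne: "vs \<noteq> []" "set vs \<subseteq> carrier G" by (auto simp: simple_chain_def)
    have "steps vs \<in> tuple k ` {..<cell_count k}"
      by (simp only: bij_betw_imp_surj_on[OF bij_betw_tuple] steps_in_simple_tuples[OF vs])
    then obtain i where i: "i < cell_count k" "tuple k i = steps vs" by (metis imageE lessThan_iff)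
    have "tuple k j = steps vs \<longleftrightarrow> j = i" if "j < cell_count k" for j
      using that i bij_betw_imp_inj_on[OF bij_betw_tuple[of k]] by (metis inj_on_eq_iff lessThan_iff)
    then have "frag_extend (\<lambda>g. frag_of (verts g (tuple k j))) (coefficient (tuple k j) (frag_of vs))
        = (if j = i then frag_of vs else 0)" if "j < cell_count k" for j
      using that i(2) verts_steps[OF ne(2,1)] by (simp add: coefficient_def eq_commute[of "steps vs"])
    then have "?t (frag_of vs) = (\<Sum>j<cell_count k. if j = i then frag_of vs else 0)"
      by (intro sum.cong) (simp_all only: lessThan_iff)
    then show ?case using i(1) by simp
  next
    case (diff a b)
    then show ?case by (simp add: coefficient_def frag_extend_diff sum_subtractf)
  qed
  moreover have "to_chain k (of_chain k z) = ?t z"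
    unfolding to_chain_def by (rule sum.cong) (simp_all add: of_chain_def)
  ultimately show ?thesis by simp
qed

lemma to_chain_inj:
  assumes "x \<in> carrier (free_term k)" "y \<in> carrier (free_term k)" "to_chain k x = to_chain k y"
  shows "x = y"
  using of_chain_to_chain assms by metis

lemma to_chain_add: "to_chain k (x \<oplus>\<^bsub>free_term k\<^esub> y) = to_chain k x + to_chain k y"
  unfolding to_chain_def sum.distrib[symmetric]
  by (rule sum.cong) (simp_all add: free_module_def frag_extend_add)

lemma to_chain_zero: "to_chain k \<zero>\<^bsub>free_term k\<^esub> = 0"
  unfolding to_chain_def by (rule sum.neutral) (simp add: free_module_def)

lemma to_chain_smult:
  assumes a: "a \<in> carrier (group_ring G)" and x: "x \<in> carrier (free_term k)"
  shows "to_chain k (a \<odot>\<^bsub>free_term k\<^esub> x) = chain_act a (to_chain k x)"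
  unfolding to_chain_def frag_act_sum[OF finite_lessThan]
proof (rule sum.cong)
  fix i assume "i \<in> {..<cell_count k}"
  then have i: "i < cell_count k" by simp
  have "frag_extend (\<lambda>g. frag_of (verts g (tuple k i))) (frag_act (\<lambda>g h. g \<otimes> h) a (x i))
      = chain_act a (frag_extend (\<lambda>g. frag_of (verts g (tuple k i))) (x i))"
  proof (rule frag_act_natural)
    show "Poly_Mapping.keys a \<subseteq> carrier G" "Poly_Mapping.keys (x i) \<subseteq> carrier G"
      using a x i by (auto simp: mem_free_term)
    fix g h assume "g \<in> carrier G" "h \<in> carrier G"
    then show "frag_of (verts (g \<otimes> h) (tuple k i))
        = frag_extend (\<lambda>vs. frag_of (map (\<lambda>v. g \<otimes> v) vs)) (frag_of (verts h (tuple k i)))"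
      using simple_tuplesD(4)[OF tuple_in[OF i]] by (simp add: map_translate_verts)
  qed
  then show "frag_extend (\<lambda>g. frag_of (verts g (tuple k i))) ((a \<odot>\<^bsub>free_term k\<^esub> x) i)
      = chain_act a (frag_extend (\<lambda>g. frag_of (verts g (tuple k i))) (x i))"
    using i by (simp add: free_module_def)
qed simp

lemma boundary_chain_act: "boundary (chain_act a z) = chain_act a (boundary z)"
proof -
  have cons: "frag_extend (\<lambda>vs. frag_of (map f vs)) (chain_cons v x)
      = chain_cons (f v) (frag_extend (\<lambda>vs. frag_of (map f vs)) x)" for f :: "'a \<Rightarrow> 'a" and v x
    by (induction x rule: frag_induction[OF subset_UNIV]) (simp_all add: chain_linear frag_extend_diff)
  have "list_boundary (map f vs) = frag_extend (\<lambda>vs. frag_of (map f vs)) (list_boundary vs)"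
    for f :: "'a \<Rightarrow> 'a" and vs
    by (induction vs) (simp_all add: frag_extend_diff cons)
  then show ?thesis
    unfolding boundary_def by (intro frag_act_natural[OF subset_UNIV subset_UNIV]) simp
qed

lemma boundary_chains:
  "Poly_Mapping.keys z \<subseteq> chains (Suc k) \<Longrightarrow> Poly_Mapping.keys (boundary z) \<subseteq> chains k"
proof (erule boundary_in)
  fix as v bs assume "as @ v # bs \<in> chains (Suc k)"
  then show "as @ bs \<in> chains k"
    using simple_chain_sublist[of as "[v]" bs] by (simp add: chains_def)
qed

text \<open>The simplicial boundary, transported to the free modules.\<close>

definition differential :: "nat \<Rightarrow> (nat \<Rightarrow> ('a \<Rightarrow>\<^sub>0 int)) \<Rightarrow> nat \<Rightarrow> ('a \<Rightarrow>\<^sub>0 int)"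
  where "differential k x = of_chain k (boundary (to_chain (Suc k) x))"

lemma differential_closed:
  "x \<in> carrier (free_term (Suc k)) \<Longrightarrow> differential k x \<in> carrier (free_term k)"
  unfolding differential_def by (intro of_chain_in boundary_chains to_chain_in)

lemma to_chain_differential:
  "x \<in> carrier (free_term (Suc k)) \<Longrightarrow> to_chain k (differential k x) = boundary (to_chain (Suc k) x)"
  unfolding differential_def by (intro to_chain_of_chain boundary_chains to_chain_in)

lemma left_module_free_term: "left_module (group_ring G) (free_term k)"
  by (rule ring.left_module_free_module[OF ring_group_ring])

lemma differential_hom: "differential k \<in> module_homs (group_ring G) (free_term (Suc k)) (free_term k)"
proof -
  interpret S: left_module "group_ring G" "free_term (Suc k)" by (rule left_module_free_term)
  interpret T: left_module "group_ring G" "free_term k" by (rule left_module_free_term)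
  show ?thesis
    unfolding module_homs_def
  proof (intro CollectI conjI ballI Pi_I)
    fix x assume x: "x \<in> carrier (free_term (Suc k))"
    show dx: "differential k x \<in> carrier (free_term k)" by (rule differential_closed[OF x])
    { fix y assume y: "y \<in> carrier (free_term (Suc k))"
      have s: "x \<oplus>\<^bsub>free_term (Suc k)\<^esub> y \<in> carrier (free_term (Suc k))" using x y by (rule S.M.a_closed)
      show "differential k (x \<oplus>\<^bsub>free_term (Suc k)\<^esub> y) = differential k x \<oplus>\<^bsub>free_term k\<^esub> differential k y"
        using to_chain_differential[OF s] to_chain_differential[OF x] to_chain_differential[OF y]
        by (intro to_chain_inj[of _ k] differential_closed[OF s] T.M.a_closed differential_closed x y)
          (simp add: to_chain_add chain_linear) }
  next
    fix a x assume a: "a \<in> carrier (group_ring G)" and x: "x \<in> carrier (free_term (Suc k))"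
    have s: "a \<odot>\<^bsub>free_term (Suc k)\<^esub> x \<in> carrier (free_term (Suc k))" using a x by (rule S.smult_closed)
    show "differential k (a \<odot>\<^bsub>free_term (Suc k)\<^esub> x) = a \<odot>\<^bsub>free_term k\<^esub> differential k x"
      using to_chain_differential[OF s] to_chain_differential[OF x]
      by (intro to_chain_inj[of _ k] differential_closed[OF s] T.smult_closed differential_closed a x)
        (simp add: to_chain_smult[OF a x] to_chain_smult[OF a differential_closed[OF x]] boundary_chain_act)
  qed
qed

lemma cell_count_0 [simp]: "cell_count 0 = 1"
  by (simp add: simple_tuples_0)

lemma boundary_to_chain_0: "boundary (to_chain 0 x) = frag_cmul (augmentation (x 0)) (frag_of [])"
proof -
  have "tuple 0 0 = []" using tuple_in[of 0 0] cell_count_0 by (simp add: simple_tuples_0)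
  then have "to_chain 0 x = frag_extend (\<lambda>g. frag_of [g]) (x 0)"
    unfolding to_chain_def cell_count_0 by simp
  moreover have "boundary (frag_extend (\<lambda>g. frag_of [g]) a) = frag_extend (\<lambda>g. frag_of []) a" for a :: "'a \<Rightarrow>\<^sub>0 int"
    by (induction a rule: frag_induction[OF subset_UNIV]) (simp_all add: chain_linear frag_extend_diff)
  ultimately show ?thesis by (simp add: frag_extend_augmentation)
qed

lemma augmentation_hom:
  "(\<lambda>x. augmentation (x 0)) \<in> module_homs (group_ring G) (free_term 0) trivial_module"
  unfolding module_homs_def cell_count_0
  by (auto simp: trivial_module_def free_module_def augmentation_simps augmentation_frag_act)

lemma differential_preimage:
  assumes x: "x \<in> carrier (free_term k)" and cyc: "boundary (to_chain k x) = 0"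
  shows "x \<in> differential k ` carrier (free_term (Suc k))"
proof -
  obtain w where w: "Poly_Mapping.keys w \<subseteq> chains (Suc k)" "boundary w = to_chain k x"
    using cycle_is_boundary[OF _ cyc, of k] to_chain_in[OF x] by (auto simp: chains_def)
  have "differential k (of_chain (Suc k) w) = x"
    unfolding differential_def using to_chain_of_chain[OF w(1)] w(2) of_chain_to_chain[OF x] by simp
  then show ?thesis using of_chain_in[OF w(1)] by blast
qed

lemma boundary_to_chain_differential:
  "x \<in> carrier (free_term (Suc k)) \<Longrightarrow> boundary (to_chain k (differential k x)) = 0"
  by (simp add: to_chain_differential boundary_boundary)

theorem left_resolution_differential:
  "left_resolution (group_ring G) free_term differential trivial_module (\<lambda>x. augmentation (x 0))"
  unfolding left_resolution_def
proof (intro conjI allI)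
  show "left_module (group_ring G) trivial_module" by (rule left_module_trivial)
  show "left_module (group_ring G) (free_term k)" for k by (rule left_module_free_term)
  show "(\<lambda>x. augmentation (x 0)) \<in> module_homs (group_ring G) (free_term 0) trivial_module"
    by (rule augmentation_hom)
  show "differential k \<in> module_homs (group_ring G) (free_term (Suc k)) (free_term k)" for k
    by (rule differential_hom)
  show "(\<lambda>x. augmentation (x 0)) ` carrier (free_term 0) = carrier trivial_module"
  proof -
    have "n \<in> (\<lambda>x. augmentation (x 0)) ` carrier (free_term 0)" for n
    proof (rule image_eqI)
      show "n = augmentation ((\<lambda>i\<in>{..<1}. frag_cmul n (frag_of \<one>)) (0::nat))"
        by (simp add: augmentation_simps)
      show "(\<lambda>i\<in>{..<1}. frag_cmul n (frag_of \<one>)) \<in> carrier (free_term 0)"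
        by (auto simp: free_module_def)
    qed
    then show ?thesis by (auto simp: trivial_module_def)
  qed
  show "a_kernel (free_term 0) trivial_module (\<lambda>x. augmentation (x 0)) = differential 0 ` carrier (free_term 1)"
  proof (intro subset_antisym subsetI)
    fix x assume "x \<in> a_kernel (free_term 0) trivial_module (\<lambda>x. augmentation (x 0))"
    then have "x \<in> carrier (free_term 0)" "augmentation (x 0) = 0"
      by (auto simp: a_kernel_def kernel_def trivial_module_def)
    then show "x \<in> differential 0 ` carrier (free_term 1)"
      using differential_preimage[of x 0] boundary_to_chain_0[of x] by simp
  next
    fix x assume "x \<in> differential 0 ` carrier (free_term 1)"
    then obtain y where y: "y \<in> carrier (free_term (Suc 0))" "x = differential 0 y" by auto
    then have "x \<in> carrier (free_term 0)" "augmentation (x 0) = 0"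
      using differential_closed[of y 0] boundary_to_chain_differential[of y 0] boundary_to_chain_0[of x]
      by auto
    then show "x \<in> a_kernel (free_term 0) trivial_module (\<lambda>x. augmentation (x 0))"
      by (auto simp: a_kernel_def kernel_def trivial_module_def)
  qed
  show "a_kernel (free_term (Suc k)) (free_term k) (differential k)
      = differential (Suc k) ` carrier (free_term (Suc (Suc k)))" for k
  proof (intro subset_antisym subsetI)
    fix x assume "x \<in> a_kernel (free_term (Suc k)) (free_term k) (differential k)"
    then have x: "x \<in> carrier (free_term (Suc k))" "differential k x = \<zero>\<^bsub>free_term k\<^esub>"
      by (auto simp: a_kernel_def kernel_def)
    then have "boundary (to_chain (Suc k) x) = 0"
      using to_chain_differential[OF x(1)] to_chain_zero by simp
    then show "x \<in> differential (Suc k) ` carrier (free_term (Suc (Suc k)))"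
      by (rule differential_preimage[OF x(1)])
  next
    fix x assume "x \<in> differential (Suc k) ` carrier (free_term (Suc (Suc k)))"
    then obtain y where y: "y \<in> carrier (free_term (Suc (Suc k)))" "x = differential (Suc k) y" by auto
    have x: "x \<in> carrier (free_term (Suc k))" using y differential_closed by simp
    have "to_chain k (differential k x) = to_chain k \<zero>\<^bsub>free_term k\<^esub>"
      using to_chain_differential[OF x] boundary_to_chain_differential[OF y(1)] y(2) to_chain_zero by simp
    moreover have "\<zero>\<^bsub>free_term k\<^esub> \<in> carrier (free_term k)"
      by (simp add: mem_free_term) (simp add: free_module_def)
    ultimately have "differential k x = \<zero>\<^bsub>free_term k\<^esub>"
      using to_chain_inj[of "differential k x" k] differential_closed[OF x] by blast
    then show "x \<in> a_kernel (free_term (Suc k)) (free_term k) (differential k)"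
      using x by (simp add: a_kernel_def kernel_def)
  qed
qed

text \<open>Each factor of a product of nontrivial simple elements adds to the length.\<close>

lemma length_le_len:
  assumes "set \<mu>s \<subseteq> D - {\<one>}"
  shows "length \<mu>s \<le> len (list_product G \<mu>s)"
  using assms
proof (induction \<mu>s)
  case (Cons \<mu> \<mu>s)
  have "list_product G ms \<in> P" if "set ms \<subseteq> D" for ms
    using that D_P by (induction ms) (auto intro: P_mult P_one)
  then have "len (list_product G \<mu>s) < len (\<mu> \<otimes> list_product G \<mu>s)"
    using Cons.prems D_P by (intro len_less) auto
  then show ?case using Cons by simp
qed simp

end

theorem theorem3p6:
  fixes G :: "('a, 'm) monoid_scheme" and P D :: "'a set" and \<Delta> :: 'a and d :: nat
  assumes "garside_group G P"
    and "garside_element (G\<lparr>carrier := P\<rparr>) \<Delta>"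
    and "D = simple_divisors (G\<lparr>carrier := P\<rparr>) \<Delta>"
    and "atom_length (G\<lparr>carrier := P\<rparr>) \<Delta> = enat d"
  shows "delta_complex_structure (garside_quotient G D) (simple_tuples G D) (bar_cell G D) \<and>
    (\<forall>k. bij_betw (\<lambda>\<mu>s. bar_cell G D k \<mu>s ` open_standard_simplex k)
      (simple_tuples G D k) (quotient_cells G D k)) \<and>
    (\<exists>\<delta>. left_resolution (group_ring G)
      (\<lambda>k. free_module (group_ring G) (if k \<le> d then card (simple_tuples G D k) else 0))
      \<delta> trivial_module (\<lambda>x. augmentation (x 0)))"
proof -
  let ?len = "\<lambda>m. the_enat (atom_length (G\<lparr>carrier := P\<rparr>) m)"
  interpret garside_order G P D ?len
    by (rule garside_order_of_garside_group[OF assms(1-3)])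
  have le: "?len p \<le> d" if "p \<in> D" for p
  proof -
    have "p \<in> right_divisors (G\<lparr>carrier := P\<rparr>) \<Delta>"
      using that assms(2,3) by (simp add: garside_element_def simple_divisors_def)
    then obtain c where c: "c \<in> P" "p \<in> P" "\<Delta> = c \<otimes>\<^bsub>G\<^esub> p"
      by (auto simp: right_divisors_def divides_opposite_submonoid)
    have "?len \<Delta> = d" using assms(4) by simp
    then show ?thesis using c len_less[of c p] by (cases "c = \<one>\<^bsub>G\<^esub>") auto
  qed
  have "simple_tuples G D k = {}" if "d < k" for k
  proof (rule equals0I)
    fix \<mu>s assume "\<mu>s \<in> simple_tuples G D k"
    then have "k \<le> ?len (list_product G \<mu>s)" "list_product G \<mu>s \<in> D"
      using length_le_len[of \<mu>s] simple_tuplesD by auto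
    then show False using le[of "list_product G \<mu>s"] that by simp
  qed
  then have "(\<lambda>k. free_module (group_ring G) (if k \<le> d then card (simple_tuples G D k) else 0)) = free_term"
    by (auto simp: fun_eq_iff)
  then show ?thesis
    using delta_complex_structure_quotient bij_betw_quotient_cells left_resolution_differential by auto
qed

end
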